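(* Let $H=\mathcal{A}+V$ be the Schrödinger operator on the tree $\mathcal{T}$, let $\gamma\in\mathbb{C}^+$ and $f:\mathcal{T}\to\mathbb{C}$. (i) If $f(v)=\int_{\partial\mathcal{T}}P_{\gamma,\xi}(v)\,\mathrm{d}\nu(\xi)$ (for all $v\in\mathcal{T}$) for some finitely additive (complex-valued) measure $\nu$ on $\mathcal{M}$, then $Hf=\gamma f$. Moreover, we must have $$\nu(\partial\mathcal{T})=f(o)\quad\text{and}\quad\nu(\partial\mathcal{T}_{u_+})=-G(o,u;\gamma)\left\{f(u_+)-\zeta_u^\gamma(u_+)f(u)\right\}\qquad( * )$$ for any $u\in\mathcal{T}$ and $u_+\in\mathcal{N}_u^+$. (ii) Conversely, if $Hf=\gamma f$, the assignment $( * )$ defines a finitely additive measure $\nu$ on $\mathcal{M}$ such that $f(v)=\int_{\partial\mathcal{T}}P_{\gamma,\xi}(v)\,\mathrm{d}\nu(\xi)$ for all $v\in\mathcal{T}$.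
   Context: Setting. $\mathcal{T}$ is a tree with uniformly bounded degree; its vertex set is also denoted $\mathcal{T}$, $w\sim v$ means that $v,w$ are nearest neighbors, $d$ is the graph distance. $V:\mathcal{T}\to\mathbb{R}$ is an arbitrary real potential and $H=\mathcal{A}+V$, i.e. $(H\psi)(v)=\sum_{w\sim v}\psi(w)+V(v)\psi(v)$, self-adjoint on $D(H)=\{\psi\in\ell^2(\mathcal{T}):V\psi\in\ell^2(\mathcal{T})\}$; for an arbitrary function $f:\mathcal{T}\to\mathbb{C}$ (not necessarily in $\ell^2$), $Hf$ is defined pointwise by the same formula. $\langle f,g\rangle=\sum_v\overline{f(v)}g(v)$. Green functions. $\mathbb{C}^+=\{z\in\mathbb{C}:\operatorname{Im}z>0\}$. For $v\sim w$, $\mathcal{T}^{(v|w)}$ is the tree obtained from $\mathcal{T}$ by removing the branch emanating from $v$ that passes through $w$ (the vertex $v$ is kept), and $H^{(v|w)}$ is the restriction of $H$ to it: $H^{(v|w)}(u,u')=H(u,u')$ if $u,u'\in\mathcal{T}^{(v|w)}$ and $0$ otherwise. For $\gamma\in\mathbb{C}\setminus\mathbb{R}$, $G(u,u';\gamma)=\langle\delta_u,(H-\gamma)^{-1}\delta_{u'}\rangle$, $G^{(v|w)}(u,u';\gamma)=\langle\delta_u,(H^{(v|w)}-\gamma)^{-1}\delta_{u'}\rangle$, and $\zeta_w^\gamma(v)=-G^{(v|w)}(v,v;\gamma)$. Boundary. An arc is a finite non-backtracking path; $[v,w]$ is the unique arc from $v$ to $w$. A chain is an infinite non-backtracking path;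 chains $(u_0,u_1,\dots)$ and $(v_0,v_1,\dots)$ are equivalent if $u_k=v_{k+n}$ for some $n\in\mathbb{Z}$ and all $k$. The geometric boundary $\partial\mathcal{T}$ is the set of equivalence classes of chains; each class $\xi$ has a representative $[v,\xi]$ starting at any given $v\in\mathcal{T}$. Fix an origin $o\in\mathcal{T}$, put $|v|=d(v,o)$ and $\mathcal{N}_u^+=\{w\sim u:|w|=|u|+1\}$. For $w\ne o$, $\partial\mathcal{T}_w=\{\xi\in\partial\mathcal{T}:[o,w]\text{ is a subchain of }[o,\xi]\}$. For $v\in\mathcal{T}$, $\xi\in\partial\mathcal{T}$, $v\wedge\xi$ is the vertex of maximal length $|\cdot|$ in $[o,v]\cap[o,\xi]$. $\mathcal{M}$ is the algebra of subsets of $\partial\mathcal{T}$ generated by the sets $\partial\mathcal{T}_v$, $v\in\mathcal{T}\setminus\{o\}$ (it contains $\partial\mathcal{T}$). Poisson kernel. For $\gamma\in\mathbb{C}^+$ and $\xi\in\partial\mathcal{T}$, $P_{\gamma,\xi}(v)=\dfrac{G(v\wedge\xi,v;\gamma)}{G(o,v\wedge\xi;\gamma)}$. For fixed $v$, the function $\xi\mapsto P_{\gamma,\xi}(v)$ takes finitely many values, and is constant on each set of $\mathcal{M}$ of the form $\partial\mathcal{T}_s$ with $|s|=n$, $n>|v|$; integrals against finitely additive measures on $\mathcal{M}$ are the corresponding finite sums. *)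

theory Defs
  imports "HOL-Analysis.Analysis"
begin

section \<open>Trees\<close>

text \<open>The vertex set is the whole type \<open>'v\<close>; \<open>E v w\<close> means that \<open>v\<close> and \<open>w\<close> are nearest
  neighbours. A cycle is a closed walk through at least three distinct vertices.\<close>

definition bounded_degree_tree :: "('v \<Rightarrow> 'v \<Rightarrow> bool) \<Rightarrow> bool" where
  "bounded_degree_tree E \<longleftrightarrow>
     symp E \<and> irreflp E \<and>
     (\<forall>v w. E\<^sup>*\<^sup>* v w) \<and>
     (\<nexists>xs. length xs \<ge> 3 \<and> distinct xs \<and> successively E xs \<and> E (last xs) (hd xs)) \<and>
     (\<exists>K. \<forall>v. finite {w. E v w} \<and> card {w. E v w} \<le> K)"

definition tree_dist :: "('v \<Rightarrow> 'v \<Rightarrow> bool) \<Rightarrow> 'v \<Rightarrow> 'v \<Rightarrow> nat" where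
  "tree_dist E v w = (LEAST n. (E ^^ n) v w)"

definition tree_arc_list :: "('v \<Rightarrow> 'v \<Rightarrow> bool) \<Rightarrow> 'v list \<Rightarrow> bool" where
  "tree_arc_list E xs \<longleftrightarrow>
     xs \<noteq> [] \<and> successively E xs \<and> (\<forall>i. i + 2 < length xs \<longrightarrow> xs ! i \<noteq> xs ! (i + 2))"

definition tree_arc :: "('v \<Rightarrow> 'v \<Rightarrow> bool) \<Rightarrow> 'v \<Rightarrow> 'v \<Rightarrow> 'v list" where
  "tree_arc E v w = (THE xs. tree_arc_list E xs \<and> hd xs = v \<and> last xs = w)"

definition forward_nbrs :: "('v \<Rightarrow> 'v \<Rightarrow> bool) \<Rightarrow> 'v \<Rightarrow> 'v \<Rightarrow> 'v set" where
  "forward_nbrs E orig u = {w. E u w \<and> tree_dist E w orig = tree_dist E u orig + 1}"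

section \<open>Geometric boundary\<close>

definition tree_chain :: "('v \<Rightarrow> 'v \<Rightarrow> bool) \<Rightarrow> (nat \<Rightarrow> 'v) \<Rightarrow> bool" where
  "tree_chain E c \<longleftrightarrow> (\<forall>k. E (c k) (c (k + 1)) \<and> c k \<noteq> c (k + 2))"

text \<open>Chains are equivalent if they agree up to an integer shift of the index for all
  sufficiently large indices. Dropping ``sufficiently large'' would relate a chain only to its own
  tails and extensions: this is not transitive, and a class would not have a representative
  starting at every vertex.\<close>

definition chain_rel :: "('v \<Rightarrow> 'v \<Rightarrow> bool) \<Rightarrow> ((nat \<Rightarrow> 'v) \<times> (nat \<Rightarrow> 'v)) set" where
  "chain_rel E = {(c, d). tree_chain E c \<and> tree_chain E d \<and> (\<exists>m n. \<forall>k. c (k + m) = d (k + n))}"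

definition tree_boundary :: "('v \<Rightarrow> 'v \<Rightarrow> bool) \<Rightarrow> (nat \<Rightarrow> 'v) set set" where
  "tree_boundary E = {c. tree_chain E c} // chain_rel E"

text \<open>The representative $[v,\xi]$.\<close>

definition tree_ray :: "'v \<Rightarrow> (nat \<Rightarrow> 'v) set \<Rightarrow> nat \<Rightarrow> 'v" where
  "tree_ray v \<xi> = (THE c. c \<in> \<xi> \<and> c 0 = v)"

text \<open>The set $\partial\mathcal{T}_w$ (for \<open>w \<noteq> orig\<close>).\<close>

definition boundary_at :: "('v \<Rightarrow> 'v \<Rightarrow> bool) \<Rightarrow> 'v \<Rightarrow> 'v \<Rightarrow> (nat \<Rightarrow> 'v) set set" where
  "boundary_at E orig w =
     {\<xi> \<in> tree_boundary E. \<exists>m n. tree_arc E orig w = map (tree_ray orig \<xi>) [m..<n]}"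

text \<open>The algebra $\mathcal{M}$: the smallest algebra of subsets of the boundary containing all
  $\partial\mathcal{T}_w$, \<open>w \<noteq> orig\<close>.\<close>

definition boundary_algebra :: "('v \<Rightarrow> 'v \<Rightarrow> bool) \<Rightarrow> 'v \<Rightarrow> (nat \<Rightarrow> 'v) set set set" where
  "boundary_algebra E orig =
     algebra (tree_boundary E) hull {boundary_at E orig w |w. w \<noteq> orig}"

text \<open>The confluent $v\wedge\xi$.\<close>

definition confluent :: "('v \<Rightarrow> 'v \<Rightarrow> bool) \<Rightarrow> 'v \<Rightarrow> 'v \<Rightarrow> (nat \<Rightarrow> 'v) set \<Rightarrow> 'v" where
  "confluent E orig v \<xi> =
     (ARG_MAX (\<lambda>x. tree_dist E x orig) x.
        x \<in> set (tree_arc E orig v) \<inter> range (tree_ray orig \<xi>))"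

text \<open>Integral of a function with finitely many values against a complex finitely additive
  measure \<open>\<nu>\<close>. It is used only for functions whose level sets are in the algebra on which \<open>\<nu>\<close>
  is additive.\<close>

definition fa_integral :: "'b set \<Rightarrow> ('b set \<Rightarrow> complex) \<Rightarrow> ('b \<Rightarrow> complex) \<Rightarrow> complex" where
  "fa_integral \<Omega> \<nu> g = (\<Sum>y\<in>g ` \<Omega>. y * \<nu> {\<xi> \<in> \<Omega>. g \<xi> = y})"

section \<open>Operators and Green functions\<close>

definition ell2 :: "('v \<Rightarrow> complex) set" where
  "ell2 = {\<psi>. (\<lambda>v. (cmod (\<psi> v))\<^sup>2) summable_on UNIV}"

definition ell2_inner :: "('v \<Rightarrow> complex) \<Rightarrow> ('v \<Rightarrow> complex) \<Rightarrow> complex" where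
  "ell2_inner f g = (\<Sum>\<^sub>\<infinity>v. cnj (f v) * g v)"

definition delta_fun :: "'v \<Rightarrow> 'v \<Rightarrow> complex" where
  "delta_fun u = (\<lambda>v. if v = u then 1 else 0)"

definition schroedinger ::
    "('v \<Rightarrow> 'v \<Rightarrow> bool) \<Rightarrow> ('v \<Rightarrow> real) \<Rightarrow> ('v \<Rightarrow> complex) \<Rightarrow> 'v \<Rightarrow> complex" where
  "schroedinger E V \<psi> v = (\<Sum>w | E v w. \<psi> w) + of_real (V v) * \<psi> v"

definition schroedinger_dom :: "('v \<Rightarrow> real) \<Rightarrow> ('v \<Rightarrow> complex) set" where
  "schroedinger_dom V = {\<psi> \<in> ell2. (\<lambda>v. of_real (V v) * \<psi> v) \<in> ell2}"

text \<open>The matrix element $\langle\delta_u,(K-\gamma)^{-1}\delta_{u'}\rangle$ of the resolvent of an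
  operator \<open>K\<close> on $\ell^2$ with domain \<open>D\<close>. The inverse is that of the bijection
  $K-\gamma : D\to\ell^2$.\<close>

definition resolvent_entry ::
    "(('v \<Rightarrow> complex) \<Rightarrow> 'v \<Rightarrow> complex) \<Rightarrow> ('v \<Rightarrow> complex) set \<Rightarrow> complex \<Rightarrow> 'v \<Rightarrow> 'v \<Rightarrow> complex" where
  "resolvent_entry K D \<gamma> u u' =
     ell2_inner (delta_fun u) (inv_into D (\<lambda>\<psi> v. K \<psi> v - \<gamma> * \<psi> v) (delta_fun u'))"

definition green ::
    "('v \<Rightarrow> 'v \<Rightarrow> bool) \<Rightarrow> ('v \<Rightarrow> real) \<Rightarrow> complex \<Rightarrow> 'v \<Rightarrow> 'v \<Rightarrow> complex" where
  "green E V \<gamma> u u' = resolvent_entry (schroedinger E V) (schroedinger_dom V) \<gamma> u u'"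

text \<open>The vertices of $\mathcal{T}^{(v|w)}$: those whose arc from \<open>v\<close> does not pass through \<open>w\<close>.\<close>

definition cut_tree :: "('v \<Rightarrow> 'v \<Rightarrow> bool) \<Rightarrow> 'v \<Rightarrow> 'v \<Rightarrow> 'v set" where
  "cut_tree E v w = {u. w \<notin> set (tree_arc E v u)}"

definition cutoff :: "'v set \<Rightarrow> ('v \<Rightarrow> complex) \<Rightarrow> 'v \<Rightarrow> complex" where
  "cutoff S \<psi> v = (if v \<in> S then \<psi> v else 0)"

text \<open>The restriction of $H$ to \<open>S\<close>, as an operator on the full $\ell^2$ space: its matrix elements
  are $H(u,u')$ for \<open>u, u' \<in> S\<close> and 0 otherwise.\<close>

definition schroedinger_on ::
    "'v set \<Rightarrow> ('v \<Rightarrow> 'v \<Rightarrow> bool) \<Rightarrow> ('v \<Rightarrow> real) \<Rightarrow> ('v \<Rightarrow> complex) \<Rightarrow> 'v \<Rightarrow> complex" where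
  "schroedinger_on S E V \<psi> = cutoff S (schroedinger E V (cutoff S \<psi>))"

definition schroedinger_on_dom :: "'v set \<Rightarrow> ('v \<Rightarrow> real) \<Rightarrow> ('v \<Rightarrow> complex) set" where
  "schroedinger_on_dom S V = {\<psi> \<in> ell2. cutoff S \<psi> \<in> schroedinger_dom V}"

definition green_cut ::
    "('v \<Rightarrow> 'v \<Rightarrow> bool) \<Rightarrow> ('v \<Rightarrow> real) \<Rightarrow> 'v \<Rightarrow> 'v \<Rightarrow> complex \<Rightarrow> 'v \<Rightarrow> 'v \<Rightarrow> complex" where
  "green_cut E V v w \<gamma> u u' =
     resolvent_entry (schroedinger_on (cut_tree E v w) E V)
       (schroedinger_on_dom (cut_tree E v w) V) \<gamma> u u'"

text \<open>$\zeta_w^\gamma(v)$\<close>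

definition zeta ::
    "('v \<Rightarrow> 'v \<Rightarrow> bool) \<Rightarrow> ('v \<Rightarrow> real) \<Rightarrow> complex \<Rightarrow> 'v \<Rightarrow> 'v \<Rightarrow> complex" where
  "zeta E V \<gamma> w v = - green_cut E V v w \<gamma> v v"

definition poisson_kernel ::
    "('v \<Rightarrow> 'v \<Rightarrow> bool) \<Rightarrow> ('v \<Rightarrow> real) \<Rightarrow> 'v \<Rightarrow> complex \<Rightarrow> (nat \<Rightarrow> 'v) set \<Rightarrow> 'v \<Rightarrow> complex" where
  "poisson_kernel E V orig \<gamma> \<xi> v =
     green E V \<gamma> (confluent E orig v \<xi>) v / green E V \<gamma> orig (confluent E orig v \<xi>)"

definition poisson_represents ::
    "('v \<Rightarrow> 'v \<Rightarrow> bool) \<Rightarrow> ('v \<Rightarrow> real) \<Rightarrow> 'v \<Rightarrow> complex \<Rightarrow> ('v \<Rightarrow> complex) \<Rightarrow>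
      ((nat \<Rightarrow> 'v) set set \<Rightarrow> complex) \<Rightarrow> bool" where
  "poisson_represents E V orig \<gamma> f \<nu> \<longleftrightarrow>
     (\<forall>v. f v = fa_integral (tree_boundary E) \<nu> (\<lambda>\<xi>. poisson_kernel E V orig \<gamma> \<xi> v))"

text \<open>The prescribed values of \<open>\<nu>\<close> on the boundary and on the generators $\partial\mathcal{T}_{u_+}$.\<close>

definition boundary_values ::
    "('v \<Rightarrow> 'v \<Rightarrow> bool) \<Rightarrow> ('v \<Rightarrow> real) \<Rightarrow> 'v \<Rightarrow> complex \<Rightarrow> ('v \<Rightarrow> complex) \<Rightarrow>
      ((nat \<Rightarrow> 'v) set set \<Rightarrow> complex) \<Rightarrow> bool" where
  "boundary_values E V orig \<gamma> f \<nu> \<longleftrightarrow>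
     \<nu> (tree_boundary E) = f orig \<and>
     (\<forall>u. \<forall>u'\<in>forward_nbrs E orig u.
        \<nu> (boundary_at E orig u') = - green E V \<gamma> orig u * (f u' - zeta E V \<gamma> u u' * f u))"

end

theory Submission
  imports Defs
begin

text \<open>
  Everything rests on one fact about Green functions on trees. If a set \<open>S\<close> of vertices is joined to
  its complement by the single edge from \<open>x \<in> S\<close> to \<open>c \<notin> S\<close>, then for every \<open>s \<notin> S\<close> the restriction
  of \<open>G(\<cdot>,s)\<close> to \<open>S\<close> solves the Dirichlet problem on \<open>S\<close> with the point source \<open>- G(c,s)\<close> at \<open>x\<close>.
  That problem has only one square-summable solution because \<open>\<gamma>\<close> is not real, so all these
  restrictions are multiples of the Green function of \<open>S\<close> (\<open>green_across_cut\<close>). Two consequences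
  are used throughout: \<open>G(w,s) = \<zeta>\<^sub>u(w) G(u,s)\<close> when \<open>s\<close> is not in the branch at \<open>w\<close> away from \<open>u\<close>,
  and \<open>G(v,s) G(c,c) = G(v,c) G(c,s)\<close> when \<open>c\<close> lies between \<open>v\<close> and \<open>s\<close>.

  By the second identity the Poisson kernel is \<open>P\<^sub>\<xi>(v) = G(v,s) / G(o,s)\<close> for every vertex \<open>s\<close> of
  the ray \<open>[o,\<xi>]\<close> with \<open>|s| \<ge> |v|\<close> (\<open>poisson_kernel_eq\<close>). Hence a Poisson integral is, for
  \<open>|v| \<le> n\<close>, the finite sum over the sphere of radius \<open>n\<close> of \<open>\<nu>(\<partial>T\<^sub>s) G(v,s) / G(o,s)\<close>
  (\<open>poisson_integral_sphere\<close>). Taking \<open>n > |v|\<close>, every summand is annihilated by \<open>H - \<gamma>\<close> at \<open>v\<close>.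
  Taking \<open>n = |w|\<close> for a forward neighbour \<open>w\<close> of \<open>u\<close>, the first identity kills all terms of
  \<open>f(w) - \<zeta>\<^sub>u(w) f(u)\<close> except \<open>s = w\<close>, which leaves the prescribed value of \<open>\<nu>(\<partial>T\<^sub>w)\<close>.

  Conversely, the prescribed value at a forward neighbour \<open>w\<close> of \<open>u\<close> is the Wronskian
  \<open>f(u) G(o,w) - f(w) G(o,u)\<close> of the two solutions \<open>f\<close> and \<open>G(o,\<cdot>)\<close>. The eigenvalue equations at
  \<open>u\<close> say exactly that these numbers are conserved from a vertex to its forward neighbours
  (\<open>weight_additive\<close>), so they define a finitely additive measure. Its Poisson integral has the
  same prescribed values as \<open>f\<close> by the first part, and the prescribed values determine a function
  by recursion on the distance from the origin, since \<open>G(o,u) \<noteq> 0\<close>. So the integral is \<open>f\<close>.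

  The resolvents themselves have to be constructed. The Dirichlet problem on a finite set is
  solvable because it is injective, with a bound that depends on \<open>Im \<gamma>\<close> only; a compactness
  argument passes to arbitrary sets (\<open>dirichlet_solution_exists\<close>).
\<close>

section \<open>Arcs, levels and cuts of a tree\<close>

text \<open>The edge from \<open>x\<close> to \<open>c\<close> is the only one that leaves \<open>S\<close>: this is all that the analysis
  needs to know about the branches of a tree.\<close>

definition sole_exit :: "('v \<Rightarrow> 'v \<Rightarrow> bool) \<Rightarrow> 'v set \<Rightarrow> 'v \<Rightarrow> 'v \<Rightarrow> bool" where
  "sole_exit E S x c \<longleftrightarrow> E x c \<and> x \<in> S \<and> c \<notin> S \<and> (\<forall>a\<in>S. \<forall>b. E a b \<longrightarrow> b \<notin> S \<longrightarrow> a = x \<and> b = c)"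

lemma sole_exitD:
  assumes "sole_exit E S x c"
  shows "E x c" "x \<in> S" "c \<notin> S"
  using assms unfolding sole_exit_def by blast+

lemma tree_arc_list_nth:
  "tree_arc_list E xs \<longleftrightarrow> xs \<noteq> [] \<and> (\<forall>i. Suc i < length xs \<longrightarrow> E (xs ! i) (xs ! Suc i))
     \<and> (\<forall>i. Suc (Suc i) < length xs \<longrightarrow> xs ! i \<noteq> xs ! Suc (Suc i))"
  by (simp add: tree_arc_list_def successively_conv_nth)

lemma tree_arc_list_singleton: "tree_arc_list E [x]"
  by (simp add: tree_arc_list_def)

lemma tree_arc_list_Cons:
  "tree_arc_list E (x # y # zs) \<longleftrightarrow> E x y \<and> tree_arc_list E (y # zs) \<and> (zs = [] \<or> x \<noteq> hd zs)"
proof -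
  have *: "(\<forall>i. P i) \<longleftrightarrow> P 0 \<and> (\<forall>i. P (Suc i))" for P :: "nat \<Rightarrow> bool"
    using not0_implies_Suc by metis
  show ?thesis
    unfolding tree_arc_list_nth
    by (subst *, subst (2) *) (auto simp: hd_conv_nth)
qed

lemma tree_arc_list_glue:
  assumes "tree_arc_list E (xs @ [v])" "tree_arc_list E (v # ys)" "xs = [] \<or> ys = [] \<or> last xs \<noteq> hd ys"
  shows "tree_arc_list E (xs @ v # ys)"
  using assms
proof (induction xs)
  case (Cons x xs)
  show ?case
  proof (cases xs)
    case Nil
    then show ?thesis using Cons.prems by (auto simp: tree_arc_list_Cons)
  next
    case (Cons x' xs')
    with Cons.prems Cons.IH show ?thesis
      by (cases xs') (auto simp: tree_arc_list_Cons)
  qed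
qed simp

lemma tree_arc_list_take:
  assumes "tree_arc_list E xs" "k > 0"
  shows "tree_arc_list E (take k xs)"
  using assms by (auto simp: tree_arc_list_nth)

locale graph_tree =
  fixes E :: "'v \<Rightarrow> 'v \<Rightarrow> bool" and orig :: 'v
  assumes tree: "bounded_degree_tree E"
begin

lemma edge_sym: "E v w \<Longrightarrow> E w v"
  using tree by (auto simp: bounded_degree_tree_def dest: sympD)

lemma edge_irrefl: "\<not> E v v"
  using tree by (auto simp: bounded_degree_tree_def dest: irreflpD)

lemma tree_connected: "E\<^sup>*\<^sup>* v w"
  using tree by (auto simp: bounded_degree_tree_def)

lemma no_cycle:
  assumes "distinct xs" "successively E xs" "E (last xs) (hd xs)" "length xs \<ge> 3"
  shows False
  using tree assms by (auto simp: bounded_degree_tree_def)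

lemma finite_nbrs: "finite {w. E v w}"
  using tree by (auto simp: bounded_degree_tree_def)

lemma tree_arc_list_rev:
  assumes "tree_arc_list E xs"
  shows "tree_arc_list E (rev xs)"
  unfolding tree_arc_list_nth
proof (intro conjI allI impI)
  show "rev xs \<noteq> []" using assms by (simp add: tree_arc_list_nth)
  fix i assume i: "Suc i < length (rev xs)"
  define j where "j = length xs - Suc (Suc i)"
  have j: "length xs - Suc i = Suc j" using i by (simp add: j_def)
  have "E (xs ! j) (xs ! Suc j)" using assms i by (auto simp: tree_arc_list_nth j_def)
  then show "E (rev xs ! i) (rev xs ! Suc i)"
    using i j edge_sym by (simp add: rev_nth j_def)
next
  fix i assume i: "Suc (Suc i) < length (rev xs)"
  define j where "j = length xs - Suc (Suc (Suc i))"
  have j: "length xs - Suc i = Suc (Suc j)" using i by (simp add: j_def)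
  have "xs ! j \<noteq> xs ! Suc (Suc j)" using assms i by (auto simp: tree_arc_list_nth j_def)
  then show "rev xs ! i \<noteq> rev xs ! Suc (Suc i)"
    using i j by (simp add: rev_nth j_def)
qed

text \<open>A first repetition in a non-backtracking walk closes a walk with distinct vertices. Its length
  cannot be one (no loops) or two (no backtracking), so it would be a cycle.\<close>

lemma tree_arc_list_distinct: "tree_arc_list E xs \<Longrightarrow> distinct xs"
proof (induction xs)
  case (Cons x ys)
  show ?case
  proof (cases ys)
    case (Cons y zs)
    with Cons.prems have arc: "tree_arc_list E ys" "E x y" and turn: "zs = [] \<or> x \<noteq> hd zs"
      by (auto simp: tree_arc_list_Cons)
    have dist: "distinct ys" using Cons.IH arc(1) by blast
    have "x \<notin> set ys"
    proof
      assume "x \<in> set ys"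
      then obtain j where j: "j < length ys" "ys ! j = x" by (auto simp: in_set_conv_nth)
      have "x \<noteq> y" using \<open>E x y\<close> edge_irrefl by blast
      then have "j \<noteq> 0" using j Cons by (intro notI) simp
      moreover have "j \<noteq> 1" using j turn Cons by (auto simp: hd_conv_nth)
      ultimately have "j \<ge> 2" by simp
      have succ: "successively E (x # take j ys)"
        using tree_arc_list_take[OF Cons.prems, of "Suc j"] by (simp add: tree_arc_list_def)
      have last: "last (x # take j ys) = ys ! (j - 1)"
        using \<open>j \<ge> 2\<close> j Cons by (simp add: last_conv_nth min_def)
      have "Suc (j - 1) = j" using \<open>j \<ge> 2\<close> by simp
      then have "E (ys ! (j - 1)) x"
        using arc(1) j by (metis tree_arc_list_nth)
      moreover have "x \<notin> set (take j ys)"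
        using dist j by (auto simp: in_set_conv_nth nth_eq_iff_index_eq)
      ultimately show False
        using no_cycle[of "x # take j ys"] succ last dist j \<open>j \<ge> 2\<close> by auto
    qed
    then show ?thesis using dist by simp
  qed simp
qed simp

definition is_arc :: "'v \<Rightarrow> 'v \<Rightarrow> 'v list \<Rightarrow> bool" where
  "is_arc v w xs \<longleftrightarrow> tree_arc_list E xs \<and> hd xs = v \<and> last xs = w"

lemma is_arc_loop:
  assumes "is_arc v v xs"
  shows "xs = [v]"
proof -
  have "xs \<noteq> []" "distinct xs" "hd xs = v" "last xs = v"
    using assms tree_arc_list_distinct by (auto simp: is_arc_def tree_arc_list_nth)
  then show ?thesis by (cases xs) (auto split: if_splits)
qed

text \<open>After the last common vertex of two different arcs, running back along one and forth along the
  other does not backtrack, yet visits their common endpoint twice.\<close>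

lemma is_arc_unique: "is_arc v w xs \<Longrightarrow> is_arc v w ys \<Longrightarrow> xs = ys"
proof (induction xs arbitrary: v ys)
  case Nil
  then show ?case by (simp add: is_arc_def tree_arc_list_nth)
next
  case (Cons x xs)
  have x: "x = v" using Cons.prems by (simp add: is_arc_def)
  obtain zs where ys: "ys = v # zs"
    using Cons.prems(2) by (cases ys) (auto simp: is_arc_def tree_arc_list_nth)
  show ?case
  proof (cases "xs = [] \<or> zs = []")
    case True
    then have "v = w" using Cons.prems ys x by (auto simp: is_arc_def)
    then show ?thesis using is_arc_loop Cons.prems by metis
  next
    case False
    then obtain a as b bs where ab: "xs = a # as" "zs = b # bs" by (meson neq_Nil_conv)
    show ?thesis
    proof (cases "a = b")
      case True
      have "is_arc a w xs" "is_arc a w zs"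
        using Cons.prems True ab x ys by (auto simp: is_arc_def tree_arc_list_Cons)
      then show ?thesis using Cons.IH x ys by blast
    next
      case F: False
      have "tree_arc_list E (rev (v # xs))"
        by (rule tree_arc_list_rev) (use Cons.prems x in \<open>auto simp: is_arc_def\<close>)
      then have l: "tree_arc_list E (rev xs @ [v])" by simp
      have "tree_arc_list E (rev xs @ v # zs)"
        by (rule tree_arc_list_glue[OF l]) (use Cons.prems ys ab F in \<open>auto simp: is_arc_def\<close>)
      then have "distinct (rev xs @ v # zs)" by (rule tree_arc_list_distinct)
      moreover have "last xs = w" "last zs = w" "xs \<noteq> []" "zs \<noteq> []"
        using Cons.prems ys ab by (auto simp: is_arc_def)
      ultimately have "w \<in> set xs" "w \<in> set zs" "set xs \<inter> set zs = {}"
        using last_in_set[of xs] last_in_set[of zs] by auto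
      then show ?thesis by blast
    qed
  qed
qed

text \<open>The arc to a neighbour of the endpoint is one step longer or one step shorter. This gives the
  existence of arcs and the level structure of the tree.\<close>

lemma is_arc_step:
  assumes "is_arc v x xs" "E x y"
  shows "is_arc v y (xs @ [y]) \<or> (\<exists>ys. is_arc v y ys \<and> xs = ys @ [x])"
proof -
  obtain zs where zs: "xs = zs @ [x]"
    using assms(1) by (metis append_butlast_last_id is_arc_def tree_arc_list_nth)
  show ?thesis
  proof (cases "zs \<noteq> [] \<and> last zs = y")
    case True
    have "is_arc v y zs"
      using tree_arc_list_take[of E xs "length zs"] assms(1) zs True by (auto simp: is_arc_def)
    then show ?thesis using zs by blast
  next
    case False
    have "tree_arc_list E (zs @ x # [y])"
      by (rule tree_arc_list_glue)
        (use assms zs False in \<open>auto simp: is_arc_def tree_arc_list_Cons tree_arc_list_singleton\<close>)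
    then show ?thesis using zs assms(1) by (cases zs) (auto simp: is_arc_def)
  qed
qed

lemma is_arc_exists: "\<exists>xs. is_arc v w xs"
  using tree_connected[of v w]
proof (induction rule: rtranclp_induct)
  case base
  show ?case by (auto simp: is_arc_def tree_arc_list_singleton intro!: exI[of _ "[v]"])
next
  case (step x y)
  then show ?case using is_arc_step by blast
qed

abbreviation arc :: "'v \<Rightarrow> 'v \<Rightarrow> 'v list" where "arc v w \<equiv> tree_arc E v w"

lemma arc_eqI: "is_arc v w xs \<Longrightarrow> arc v w = xs"
  unfolding tree_arc_def by (rule the_equality) (auto simp: is_arc_def intro: is_arc_unique[unfolded is_arc_def])

lemma is_arc_arc: "is_arc v w (arc v w)"
  using is_arc_exists arc_eqI by metis

lemma arc_list: "tree_arc_list E (arc v w)"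
  and arc_hd: "hd (arc v w) = v"
  and arc_last: "last (arc v w) = w"
  and arc_nonempty: "arc v w \<noteq> []"
  using is_arc_arc[of v w] by (auto simp: is_arc_def tree_arc_list_nth)

lemma arc_self: "arc v v = [v]"
  by (rule arc_eqI) (simp add: is_arc_def tree_arc_list_singleton)

lemma arc_step:
  assumes "E x y"
  shows "arc v y = arc v x @ [y] \<or> arc v x = arc v y @ [x]"
  using is_arc_step[OF is_arc_arc assms, of v] arc_eqI by blast

lemma arc_rev: "arc w v = rev (arc v w)"
  by (rule arc_eqI)
    (simp add: is_arc_def tree_arc_list_rev[OF arc_list] hd_rev last_rev arc_hd arc_last)

lemma arc_take:
  assumes "k < length (arc v w)"
  shows "arc v (arc v w ! k) = take (Suc k) (arc v w)"
proof (rule arc_eqI)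
  have "take (Suc k) (arc v w) = take k (arc v w) @ [arc v w ! k]"
    using assms by (simp add: take_Suc_conv_app_nth)
  moreover have "hd (take (Suc k) (arc v w)) = v"
    using arc_hd[of v w] arc_nonempty[of v w] by (simp add: hd_take)
  ultimately show "is_arc v (arc v w ! k) (take (Suc k) (arc v w))"
    using tree_arc_list_take[OF arc_list, of "Suc k" v w] by (simp add: is_arc_def)
qed

definition lev :: "'v \<Rightarrow> nat" where "lev v = tree_dist E v orig"

lemma length_arc_le:
  assumes "(E ^^ n) v w"
  shows "length (arc v w) \<le> Suc n"
  using assms
proof (induction n arbitrary: w)
  case 0
  then show ?case by (simp add: arc_self)
next
  case (Suc n)
  then obtain x where "(E ^^ n) v x" "E x w" by auto
  with Suc.IH[of x] arc_step[of x w v] show ?case by force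
qed

lemma relpowp_tree_arc_list:
  "tree_arc_list E xs \<Longrightarrow> (E ^^ (length xs - 1)) (hd xs) (last xs)"
proof (induction xs)
  case (Cons x xs)
  show ?case
  proof (cases xs)
    case Nil
    then show ?thesis by simp
  next
    case C: (Cons y zs)
    with Cons.prems have "E x y" "tree_arc_list E xs" by (auto simp: tree_arc_list_Cons)
    with Cons.IH C have "(E ^^ (length zs)) y (last xs)" by auto
    with \<open>E x y\<close> have "(E ^^ Suc (length zs)) x (last xs)"
      by (rule relpowp_Suc_I2)
    then show ?thesis using C by simp
  qed
qed (simp add: tree_arc_list_nth)

lemma length_arc: "length (arc orig v) = Suc (lev v)"
proof -
  have "tree_dist E v orig = length (arc v orig) - 1"
    unfolding tree_dist_def
  proof (rule Least_equality)
    show "(E ^^ (length (arc v orig) - 1)) v orig"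
      using relpowp_tree_arc_list[OF arc_list] by (simp add: arc_hd arc_last)
    show "length (arc v orig) - 1 \<le> n" if "(E ^^ n) v orig" for n
      using length_arc_le[OF that] by simp
  qed
  moreover have "length (arc v orig) \<noteq> 0" using arc_nonempty by simp
  ultimately show ?thesis unfolding lev_def arc_rev[of orig v] by simp
qed

lemma lev_orig: "lev orig = 0"
  using length_arc[of orig] by (simp add: arc_self)

lemma lev_eq_0: "lev v = 0 \<longleftrightarrow> v = orig"
proof
  assume "lev v = 0"
  then have "length (arc orig v) = 1" by (simp add: length_arc)
  then obtain a where "arc orig v = [a]" by (auto simp: length_Suc_conv)
  then show "v = orig" using arc_hd[of orig v] arc_last[of orig v] by simp
qed (simp add: lev_orig)

lemma arc_up: "E v w \<Longrightarrow> lev w = Suc (lev v) \<Longrightarrow> arc orig w = arc orig v @ [w]"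
  using arc_step[of v w orig] length_arc[of v] length_arc[of w] by auto

lemma lev_nbr: "E v w \<Longrightarrow> lev w = Suc (lev v) \<or> lev v = Suc (lev w)"
  using arc_step[of v w orig] length_arc[of v] length_arc[of w] by auto

lemma parent_unique:
  assumes "E v w" "E v' w" "lev w = Suc (lev v)" "lev w = Suc (lev v')"
  shows "v = v'"
  using arc_up[OF assms(1,3)] arc_up[OF assms(2,4)] arc_last by (metis append1_eq_conv)

lemma arc_nth_last: "arc orig v ! lev v = v"
  using arc_last[of orig v] length_arc[of v] arc_nonempty[of orig v] by (simp add: last_conv_nth)

lemma arc_nth_0: "arc orig v ! 0 = orig"
  using arc_hd[of orig v] arc_nonempty[of orig v] by (simp add: hd_conv_nth)

lemma lev_arc_nth:
  assumes "k \<le> lev v"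
  shows "lev (arc orig v ! k) = k"
proof -
  have "length (arc orig (arc orig v ! k)) = Suc k"
    using arc_take[of k orig v] assms by (simp add: length_arc)
  then show ?thesis by (simp add: length_arc)
qed

lemma arc_nth_edge: "k < lev v \<Longrightarrow> E (arc orig v ! k) (arc orig v ! Suc k)"
  using arc_list[of orig v] by (simp add: tree_arc_list_nth length_arc)

lemma set_arc: "x \<in> set (arc orig v) \<longleftrightarrow> lev x \<le> lev v \<and> arc orig v ! lev x = x"
proof
  assume "x \<in> set (arc orig v)"
  then obtain k where "k < Suc (lev v)" "arc orig v ! k = x"
    by (auto simp: in_set_conv_nth length_arc)
  then show "lev x \<le> lev v \<and> arc orig v ! lev x = x" using lev_arc_nth[of k v] by auto
next
  assume "lev x \<le> lev v \<and> arc orig v ! lev x = x"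
  then show "x \<in> set (arc orig v)" by (metis length_arc less_Suc_eq_le nth_mem)
qed

lemma parent_exists:
  assumes "v \<noteq> orig"
  obtains u where "E u v" "lev v = Suc (lev u)"
proof -
  have "lev v \<noteq> 0" using assms lev_eq_0 by simp
  then obtain n where n: "lev v = Suc n" by (cases "lev v") auto
  have "E (arc orig v ! n) v" using arc_nth_edge[of n v] arc_nth_last[of v] n by simp
  moreover have "lev (arc orig v ! n) = n" using lev_arc_nth n by simp
  ultimately show thesis using that n by metis
qed

definition sphere_at :: "nat \<Rightarrow> 'v set" where "sphere_at n = {v. lev v = n}"

lemma sphere_at_lev: "v \<in> sphere_at (lev v)"
  by (simp add: sphere_at_def)

lemma finite_sphere: "finite (sphere_at n)"
proof (induction n)
  case 0
  have "sphere_at 0 = {orig}" by (auto simp: sphere_at_def lev_eq_0)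
  then show ?case by simp
next
  case (Suc n)
  have "sphere_at (Suc n) \<subseteq> (\<Union>u\<in>sphere_at n. {w. E u w})"
  proof
    fix v assume v: "v \<in> sphere_at (Suc n)"
    then have "v \<noteq> orig" by (auto simp: sphere_at_def lev_orig)
    then show "v \<in> (\<Union>u\<in>sphere_at n. {w. E u w})"
      using parent_exists[of v] v by (auto simp: sphere_at_def)
  qed
  then show ?case using Suc finite_nbrs by (meson finite_UN finite_subset)
qed

lemma forward_nbrs_iff: "w \<in> forward_nbrs E orig u \<longleftrightarrow> E u w \<and> lev w = Suc (lev u)"
  by (simp add: forward_nbrs_def lev_def)

lemma finite_forward_nbrs: "finite (forward_nbrs E orig u)"
  by (rule finite_subset[OF _ finite_nbrs[of u]]) (auto simp: forward_nbrs_iff)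

text \<open>If the arcs from \<open>v\<close> to two adjacent vertices differ in whether they visit \<open>w\<close>, one extends the other
  by the vertex \<open>w\<close>; as the arc from \<open>v\<close> to \<open>w\<close> is the edge itself, the crossing is that edge.\<close>

lemma cut_tree_sole_exit:
  assumes "E v w"
  shows "sole_exit E (cut_tree E v w) v w"
  unfolding sole_exit_def
proof (intro conjI ballI allI impI)
  show "E v w" by fact
  have "v \<noteq> w" using assms edge_irrefl by blast
  then show "v \<in> cut_tree E v w" by (simp add: cut_tree_def arc_self)
  show "w \<notin> cut_tree E v w"
    unfolding cut_tree_def using arc_last arc_nonempty by (metis last_in_set mem_Collect_eq)
  have arc_vw: "arc v w = [v, w]"
    by (rule arc_eqI) (use assms \<open>v \<noteq> w\<close> in \<open>simp add: is_arc_def tree_arc_list_Cons tree_arc_list_singleton\<close>)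
  fix a b assume ab: "a \<in> cut_tree E v w" "E a b" "b \<notin> cut_tree E v w"
  then have a: "w \<notin> set (arc v a)" and b: "w \<in> set (arc v b)" by (auto simp: cut_tree_def)
  then have "arc v b = arc v a @ [b]" using arc_step[OF ab(2), of v] by auto
  moreover from this show "b = w" using a b by auto
  ultimately have "arc v a = [v]" using arc_vw by simp
  then show "a = v" using arc_last[of v a] by simp
qed

text \<open>To leave \<open>S\<close> a walk must visit \<open>c\<close>, and to enter \<open>S\<close> it must visit \<open>x\<close>. These two lemmas
  decide on which side of a cut a vertex lies.\<close>

lemma sole_exit_walk_inside:
  assumes "sole_exit E S x c" "i \<le> j" "p i \<in> S"
    and "\<And>k. i \<le> k \<Longrightarrow> k < j \<Longrightarrow> E (p k) (p (Suc k))" "\<And>k. i \<le> k \<Longrightarrow> k \<le> j \<Longrightarrow> p k \<noteq> c"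
  shows "p j \<in> S"
  using assms(2)
proof (induction rule: dec_induct)
  case base
  show ?case by fact
next
  case (step n)
  then show ?case using assms(1) assms(4)[of n] assms(5)[of "Suc n"] unfolding sole_exit_def by auto
qed

lemma sole_exit_walk_outside:
  assumes "sole_exit E S x c" "i \<le> j" "p i \<notin> S"
    and "\<And>k. i \<le> k \<Longrightarrow> k < j \<Longrightarrow> E (p k) (p (Suc k))" "\<And>k. i \<le> k \<Longrightarrow> k \<le> j \<Longrightarrow> p k \<noteq> x"
  shows "p j \<notin> S"
  using assms(2)
proof (induction rule: dec_induct)
  case base
  show ?case by fact
next
  case (step n)
  then show ?case using assms(1) edge_sym[OF assms(4)[of n]] assms(5)[of "Suc n"] unfolding sole_exit_def by auto
qed

section \<open>Rays and the boundary\<close>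

text \<open>Having gone up once, a chain can never come down: the only lower neighbour of its current
  vertex is the one it came from.\<close>

lemma chain_rising:
  assumes "tree_chain E c" "lev (c 1) = Suc (lev (c 0))"
  shows "lev (c k) = lev (c 0) + k"
proof -
  have "lev (c k) = lev (c 0) + k \<and> lev (c (Suc k)) = lev (c 0) + Suc k"
  proof (induction k)
    case 0
    then show ?case using assms by simp
  next
    case (Suc k)
    have e: "E (c k) (c (Suc k))" "E (c (Suc k)) (c (Suc (Suc k)))" "c k \<noteq> c (Suc (Suc k))"
      using assms(1) unfolding tree_chain_def by (metis Suc_eq_plus1 add_2_eq_Suc')+
    then show ?case
      using lev_nbr[OF e(2)] parent_unique[OF e(1) edge_sym[OF e(2)]] Suc by auto
  qed
  then show ?thesis by blast
qed

lemma chain_from_origin_lev: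
  assumes "tree_chain E c" "c 0 = orig"
  shows "lev (c k) = k"
proof -
  have "E (c 0) (c 1)" using assms(1) by (simp add: tree_chain_def)
  then have "lev (c 1) = Suc (lev (c 0))" using lev_nbr assms(2) lev_orig by force
  from chain_rising[OF assms(1) this, of k] show ?thesis using assms(2) lev_orig by simp
qed

lemma rising_chain_unique_history:
  assumes "\<And>k. E (c k) (c (Suc k))" "\<And>k. E (d k) (d (Suc k))"
    and "\<And>k. lev (c k) = k" "\<And>k. lev (d k) = k" "c n = d n" "k \<le> n"
  shows "c k = d k"
  using assms(6)
proof (induction rule: inc_induct)
  case base
  show ?case by fact
next
  case (step k)
  then show ?case using parent_unique[of "c k" "c (Suc k)" "d k"] assms(1-4) by metis
qed

lemma tree_chain_edge: "tree_chain E c \<Longrightarrow> E (c k) (c (Suc k))"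
  by (simp add: tree_chain_def)

lemma equiv_chain_rel: "equiv {c. tree_chain E c} (chain_rel E)"
proof (rule equivI)
  show "chain_rel E \<subseteq> {c. tree_chain E c} \<times> {c. tree_chain E c}"
    by (auto simp: chain_rel_def)
  show "refl_on {c. tree_chain E c} (chain_rel E)"
    by (auto simp: refl_on_def chain_rel_def intro!: exI[of _ 0])
  show "sym (chain_rel E)" by (rule symI) (auto simp: chain_rel_def, metis)
  show "trans (chain_rel E)"
  proof (rule transI)
    fix a b c assume "(a, b) \<in> chain_rel E" "(b, c) \<in> chain_rel E"
    then obtain m n m' n' where h: "tree_chain E a" "tree_chain E c"
      "\<And>k. a (k + m) = b (k + n)" "\<And>k. b (k + m') = c (k + n')"
      by (auto simp: chain_rel_def)
    have "a (k + (m + m')) = c (k + (n + n'))" for k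
      using h(3)[of "k + m'"] h(4)[of "k + n"] by (simp add: add_ac)
    then show "(a, c) \<in> chain_rel E" using h(1,2) by (auto simp: chain_rel_def)
  qed
qed

text \<open>Put the arc from the origin to \<open>c 0\<close> in front of \<open>c\<close>. The level of the \<open>k\<close>-th vertex is then
  \<open>k\<close>, which excludes backtracking at the junction.\<close>

lemma chain_prolong_to_origin:
  assumes "tree_chain E c" "lev (c 1) = Suc (lev (c 0))"
  obtains d where "tree_chain E d" "d 0 = orig" "(c, d) \<in> chain_rel E" "d (lev (c 0)) = c 0"
proof -
  define L where "L = lev (c 0)"
  define d where "d = (\<lambda>k. if k < L then arc orig (c 0) ! k else c (k - L))"
  have low: "d k = arc orig (c 0) ! k" if "k \<le> L" for k
    using that arc_nth_last[of "c 0"] by (auto simp: d_def L_def)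
  have high: "d (k + L) = c k" for k by (simp add: d_def)
  have lev: "lev (d k) = k" for k
  proof (cases "k \<le> L")
    case True
    then show ?thesis using low lev_arc_nth[of k "c 0"] by (simp add: L_def)
  next
    case False
    then show ?thesis using chain_rising[OF assms, of "k - L"] by (simp add: d_def L_def)
  qed
  have "E (d k) (d (Suc k))" for k
  proof (cases "k < L")
    case True
    then show ?thesis using low arc_nth_edge[of k "c 0"] by (simp add: L_def)
  next
    case False
    then show ?thesis using tree_chain_edge[OF assms(1), of "k - L"] by (simp add: d_def Suc_diff_le)
  qed
  moreover have "d k \<noteq> d (k + 2)" for k using lev[of k] lev[of "k + 2"] by auto
  ultimately have chain: "tree_chain E d" by (simp add: tree_chain_def)
  have "d 0 = orig" using low[of 0] arc_nth_0 by simp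
  moreover have "(c, d) \<in> chain_rel E"
  proof -
    have "\<forall>k. c (k + 0) = d (k + L)" using high by simp
    then show ?thesis unfolding chain_rel_def using assms(1) chain by blast
  qed
  moreover have "d L = c 0" using high[of 0] by simp
  ultimately show thesis using that chain unfolding L_def by blast
qed

lemma related_chains_from_origin_eq:
  assumes "(c, d) \<in> chain_rel E" "c 0 = orig" "d 0 = orig"
  shows "c = d"
proof
  fix k
  obtain m n where ch: "tree_chain E c" "tree_chain E d" and mn: "\<And>k. c (k + m) = d (k + n)"
    using assms(1) by (auto simp: chain_rel_def)
  note lev = chain_from_origin_lev[OF ch(1) assms(2)] chain_from_origin_lev[OF ch(2) assms(3)]
  have "m = n" using mn[of 0] lev(1)[of m] lev(2)[of n] by simp
  show "c k = d k"
    by (rule rising_chain_unique_history[of c d "k + m"])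
      (use tree_chain_edge ch lev mn \<open>m = n\<close> in auto)
qed

text \<open>A chain of the class, started at its vertex of least level, rises from there on, so it can be
  prolonged to the origin. Uniqueness: eventually equal rising chains are equal, because parents are
  unique.\<close>

lemma ray_unique_exists:
  assumes "\<xi> \<in> tree_boundary E"
  shows "\<exists>!c. c \<in> \<xi> \<and> c 0 = orig"
proof -
  obtain c where c: "tree_chain E c" "\<xi> = chain_rel E `` {c}"
    using assms by (auto simp: tree_boundary_def quotient_def)
  obtain m where m: "\<And>k. lev (c m) \<le> lev (c k)"
    using exists_least_iff[of "\<lambda>n. \<exists>k. lev (c k) = n"] by (metis linorder_not_less)
  define c' where "c' = (\<lambda>k. c (k + m))"
  have c': "tree_chain E c'" using c(1) by (simp add: c'_def tree_chain_def add_ac)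
  have "lev (c' 1) = Suc (lev (c' 0))"
    using lev_nbr[OF tree_chain_edge[OF c', of 0]] m[of "Suc m"] by (auto simp: c'_def)
  then obtain d where d: "d 0 = orig" "(c', d) \<in> chain_rel E"
    using chain_prolong_to_origin[OF c'] by metis
  have "(c, c') \<in> chain_rel E"
  proof -
    have "\<forall>k. c (k + m) = c' (k + 0)" by (simp add: c'_def)
    then show ?thesis unfolding chain_rel_def using c(1) c' by blast
  qed
  then have "(c, d) \<in> chain_rel E" using d(2) equiv_chain_rel by (meson equivE transD)
  then have "d \<in> \<xi>" using c(2) by simp
  moreover have "x = y" if "x \<in> \<xi>" "y \<in> \<xi>" "x 0 = orig" "y 0 = orig" for x y
  proof -
    have "(x, y) \<in> chain_rel E"
      using that(1,2) c(2) equiv_chain_rel by (meson Image_singleton_iff equivE symD transD)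
    then show ?thesis using that(3,4) related_chains_from_origin_eq by blast
  qed
  ultimately show ?thesis using d(1) by blast
qed

abbreviation ray :: "(nat \<Rightarrow> 'v) set \<Rightarrow> nat \<Rightarrow> 'v" where "ray \<equiv> tree_ray orig"

lemma ray_props:
  assumes "\<xi> \<in> tree_boundary E"
  shows "ray \<xi> \<in> \<xi>" "ray \<xi> 0 = orig"
  using theI'[OF ray_unique_exists[OF assms]] by (auto simp: tree_ray_def)

lemma ray_eqI: "\<xi> \<in> tree_boundary E \<Longrightarrow> c \<in> \<xi> \<Longrightarrow> c 0 = orig \<Longrightarrow> ray \<xi> = c"
  using ray_props ray_unique_exists by blast

lemma ray_chain:
  assumes "\<xi> \<in> tree_boundary E"
  shows "tree_chain E (ray \<xi>)"
  using ray_props(1)[OF assms] assms by (auto simp: tree_boundary_def quotient_def chain_rel_def)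

lemma ray_edge: "\<xi> \<in> tree_boundary E \<Longrightarrow> E (ray \<xi> k) (ray \<xi> (Suc k))"
  using ray_chain tree_chain_edge by blast

lemma ray_lev: "\<xi> \<in> tree_boundary E \<Longrightarrow> lev (ray \<xi> k) = k"
  using chain_from_origin_lev ray_chain ray_props(2) by blast

lemma arc_ray:
  assumes "\<xi> \<in> tree_boundary E"
  shows "arc orig (ray \<xi> n) = map (ray \<xi>) [0..<Suc n]"
proof (induction n)
  case 0
  then show ?case by (simp add: ray_props(2)[OF assms] arc_self)
next
  case (Suc n)
  then show ?case using arc_up[OF ray_edge[OF assms, of n]] by (simp add: ray_lev[OF assms])
qed

abbreviation bdry :: "'v \<Rightarrow> (nat \<Rightarrow> 'v) set set" where "bdry \<equiv> boundary_at E orig"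

text \<open>The vertex of a ray at level \<open>n\<close> is its \<open>n\<close>-th vertex, so an arc from the origin can only be an
  initial segment of the ray. With this description \<open>w = orig\<close> gives the whole boundary.\<close>

lemma bdry_iff: "\<xi> \<in> bdry w \<longleftrightarrow> \<xi> \<in> tree_boundary E \<and> ray \<xi> (lev w) = w"
proof (intro iffI conjI)
  assume "\<xi> \<in> bdry w"
  then obtain m n where \<xi>: "\<xi> \<in> tree_boundary E" and mn: "arc orig w = map (ray \<xi>) [m..<n]"
    by (auto simp: boundary_at_def)
  then have "m < n" using arc_nonempty[of orig w] by auto
  then have "last (arc orig w) = ray \<xi> (n - 1)"
    unfolding mn by (simp add: last_map)
  then have "w = ray \<xi> (n - 1)" using arc_last by metis
  then show "ray \<xi> (lev w) = w" using ray_lev[OF \<xi>, of "n - 1"] by simp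
  show "\<xi> \<in> tree_boundary E" by fact
next
  assume a: "\<xi> \<in> tree_boundary E \<and> ray \<xi> (lev w) = w"
  then have "arc orig w = map (ray \<xi>) [0..<Suc (lev w)]" using arc_ray[of \<xi> "lev w"] by simp
  then show "\<xi> \<in> bdry w" unfolding boundary_at_def using a by blast
qed

lemma bdry_orig: "bdry orig = tree_boundary E"
  by (auto simp: bdry_iff lev_orig ray_props(2))

lemma bdry_ray: "\<xi> \<in> tree_boundary E \<Longrightarrow> \<xi> \<in> bdry (ray \<xi> n)"
  by (simp add: bdry_iff ray_lev)

lemma bdry_disjoint: "lev v = lev w \<Longrightarrow> v \<noteq> w \<Longrightarrow> bdry v \<inter> bdry w = {}"
  by (auto simp: bdry_iff)

text \<open>This is how an infinite branch is shown to have boundary points.\<close>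

lemma rising_chain_meets_boundary:
  assumes "tree_chain E c" "lev (c 1) = Suc (lev (c 0))"
  shows "bdry (c 0) \<noteq> {}"
proof -
  obtain d where d: "d 0 = orig" "(c, d) \<in> chain_rel E" "d (lev (c 0)) = c 0"
    using chain_prolong_to_origin[OF assms] by metis
  define \<xi> where "\<xi> = chain_rel E `` {c}"
  have \<xi>: "\<xi> \<in> tree_boundary E" using assms(1) by (auto simp: \<xi>_def tree_boundary_def quotient_def)
  have "ray \<xi> = d" by (rule ray_eqI[OF \<xi>]) (use d in \<open>auto simp: \<xi>_def\<close>)
  then have "\<xi> \<in> bdry (c 0)" using \<xi> d(3) by (simp add: bdry_iff)
  then show ?thesis by blast
qed

lemma boundary_at_children:
  "bdry u = (\<Union>w\<in>forward_nbrs E orig u. bdry w)"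
proof (intro set_eqI iffI)
  fix \<xi> assume "\<xi> \<in> bdry u"
  then have \<xi>: "\<xi> \<in> tree_boundary E" "ray \<xi> (lev u) = u" by (auto simp: bdry_iff)
  have "ray \<xi> (Suc (lev u)) \<in> forward_nbrs E orig u"
    using ray_edge[OF \<xi>(1), of "lev u"] \<xi> by (simp add: forward_nbrs_iff ray_lev)
  then show "\<xi> \<in> (\<Union>w\<in>forward_nbrs E orig u. bdry w)" using bdry_ray[OF \<xi>(1)] by blast
next
  fix \<xi> assume "\<xi> \<in> (\<Union>w\<in>forward_nbrs E orig u. bdry w)"
  then obtain w where w: "E u w" "lev w = Suc (lev u)" "\<xi> \<in> tree_boundary E" "ray \<xi> (lev w) = w"
    by (auto simp: forward_nbrs_iff bdry_iff)
  have "ray \<xi> (lev u) = u"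
    by (rule parent_unique[of _ w]) (use w ray_edge[OF w(3), of "lev u"] ray_lev[OF w(3)] in auto)
  then show "\<xi> \<in> bdry u" using w(3) by (simp add: bdry_iff)
qed

text \<open>The maximum in the definition of the confluent is attained: levels on the arc are bounded, and
  the origin is a candidate.\<close>

lemma confluent_props:
  fixes v :: 'v
  assumes "\<xi> \<in> tree_boundary E"
  defines "c \<equiv> confluent E orig v \<xi>"
  shows "c \<in> set (arc orig v)" "c = ray \<xi> (lev c)"
    and "\<And>x. x \<in> set (arc orig v) \<Longrightarrow> x \<in> range (ray \<xi>) \<Longrightarrow> lev x \<le> lev c"
proof -
  define P where "P = (\<lambda>x. x \<in> set (arc orig v) \<inter> range (ray \<xi>))"
  have P0: "P orig"
    using ray_props(2)[OF assms(1)] arc_hd[of orig v] arc_nonempty[of orig v]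
    by (auto simp: P_def image_iff) (metis hd_in_set, metis)
  have bd: "lev x < Suc (lev v)" if "P x" for x using that by (auto simp: P_def set_arc)
  have c: "c = arg_max lev P" unfolding c_def confluent_def P_def lev_def ..
  have "P c" unfolding c by (rule arg_max_natI[of P orig lev "Suc (lev v)"]) (use P0 bd in auto)
  then show "c \<in> set (arc orig v)" by (simp add: P_def)
  have "c \<in> range (ray \<xi>)" using \<open>P c\<close> by (simp add: P_def)
  then show "c = ray \<xi> (lev c)" using ray_lev[OF assms(1)] by auto
  fix x assume "x \<in> set (arc orig v)" "x \<in> range (ray \<xi>)"
  then have "P x" by (simp add: P_def)
  then show "lev x \<le> lev c" unfolding c
    by (rule arg_max_nat_le[of P x lev "Suc (lev v)"]) (use bd in auto)
qed

end

section \<open>Square-summable functions on a graph of bounded degree\<close>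

lemma ell2_iff_abs_summable: "\<psi> \<in> ell2 \<longleftrightarrow> (\<lambda>v. norm (\<psi> v * \<psi> v)) summable_on UNIV"
  by (simp add: ell2_def norm_mult power2_eq_square)

lemma ell2_mult_abs_summable:
  assumes "\<psi> \<in> ell2" "\<phi> \<in> ell2"
  shows "(\<lambda>v. norm (\<psi> v * \<phi> v)) summable_on UNIV"
  by (rule abs_summable_product) (use assms in \<open>auto simp: ell2_iff_abs_summable[symmetric]\<close>)

lemma ell2_mult_summable:
  assumes "\<psi> \<in> ell2" "\<phi> \<in> ell2"
  shows "(\<lambda>v. \<psi> v * \<phi> v) summable_on UNIV"
  using ell2_mult_abs_summable[OF assms] by (rule abs_summable_summable)

lemma ell2_dominated:
  assumes "g summable_on UNIV" "\<And>v. (cmod (\<psi> v))\<^sup>2 \<le> g v"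
  shows "\<psi> \<in> ell2"
  unfolding ell2_def mem_Collect_eq by (rule summable_on_comparison_test[OF assms(1)]) (use assms in auto)

lemma ell2_cmult: "\<psi> \<in> ell2 \<Longrightarrow> (\<lambda>v. c * \<psi> v) \<in> ell2"
  unfolding ell2_def by (simp add: norm_mult power_mult_distrib summable_on_cmult_right)

lemma ell2_cnj: "\<psi> \<in> ell2 \<Longrightarrow> (\<lambda>v. cnj (\<psi> v)) \<in> ell2"
  by (simp add: ell2_def)

lemma ell2_add:
  assumes "\<psi> \<in> ell2" "\<phi> \<in> ell2"
  shows "(\<lambda>v. \<psi> v + \<phi> v) \<in> ell2"
proof (rule ell2_dominated)
  show "(\<lambda>v. 2 * (cmod (\<psi> v))\<^sup>2 + 2 * (cmod (\<phi> v))\<^sup>2) summable_on UNIV"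
    using assms by (auto simp: ell2_def intro!: summable_on_add summable_on_cmult_right)
  fix v
  have "(cmod (\<psi> v + \<phi> v))\<^sup>2 \<le> (cmod (\<psi> v) + cmod (\<phi> v))\<^sup>2"
    by (intro power_mono norm_triangle_ineq) auto
  also have "\<dots> \<le> 2 * (cmod (\<psi> v))\<^sup>2 + 2 * (cmod (\<phi> v))\<^sup>2"
    using sum_squares_bound[of "cmod (\<psi> v)" "cmod (\<phi> v)"] by (simp add: power2_sum)
  finally show "(cmod (\<psi> v + \<phi> v))\<^sup>2 \<le> 2 * (cmod (\<psi> v))\<^sup>2 + 2 * (cmod (\<phi> v))\<^sup>2" .
qed

lemma ell2_diff:
  assumes "\<psi> \<in> ell2" "\<phi> \<in> ell2"
  shows "(\<lambda>v. \<psi> v - \<phi> v) \<in> ell2"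
  using ell2_add[OF assms(1) ell2_cmult[OF assms(2), of "-1"]] by simp

lemma ell2_cutoff:
  assumes "\<psi> \<in> ell2"
  shows "cutoff S \<psi> \<in> ell2"
  by (rule ell2_dominated[of "\<lambda>v. (cmod (\<psi> v))\<^sup>2"]) (use assms in \<open>auto simp: ell2_def cutoff_def\<close>)

lemma ell2_finite_support:
  assumes "finite F" "\<And>v. v \<notin> F \<Longrightarrow> \<psi> v = 0"
  shows "\<psi> \<in> ell2"
proof -
  have "(\<lambda>v. (cmod (\<psi> v))\<^sup>2) summable_on F"
    using assms(1) by (rule summable_on_finite)
  also have "?this \<longleftrightarrow> (\<lambda>v. (cmod (\<psi> v))\<^sup>2) summable_on UNIV"
    by (rule summable_on_cong_neutral) (use assms in auto)
  finally show ?thesis by (simp add: ell2_def)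
qed

lemma infsum_single_support:
  fixes g :: "'v \<Rightarrow> complex"
  assumes "\<And>v. v \<noteq> x \<Longrightarrow> g v = 0"
  shows "infsum g UNIV = g x"
proof -
  have "infsum g UNIV = infsum g {x}"
    by (rule infsum_cong_neutral) (use assms in auto)
  then show ?thesis by simp
qed

lemma infsum_delta:
  fixes g :: "'v \<Rightarrow> complex"
  shows "(\<Sum>\<^sub>\<infinity>v. if v = x then g v else 0) = g x"
  by (subst infsum_single_support[of x]) auto

lemma summable_on_delta:
  fixes g :: "'v \<Rightarrow> complex"
  shows "(\<lambda>v. if v = x then g v else 0) summable_on UNIV"
  by (rule iffD1[OF summable_on_cong_neutral[of UNIV "{x}" _ g]]) auto

lemma ell2_inner_delta: "ell2_inner (delta_fun u) g = g u"
  unfolding ell2_inner_def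
  by (subst infsum_single_support[of u]) (auto simp: delta_fun_def)

lemma domD: "\<psi> \<in> schroedinger_dom V \<Longrightarrow> \<psi> \<in> ell2"
  "\<psi> \<in> schroedinger_dom V \<Longrightarrow> (\<lambda>v. of_real (V v) * \<psi> v) \<in> ell2"
  by (auto simp: schroedinger_dom_def)

lemma dom_cmult: "\<psi> \<in> schroedinger_dom V \<Longrightarrow> (\<lambda>v. c * \<psi> v) \<in> schroedinger_dom V"
  using ell2_cmult[of \<psi> c] ell2_cmult[of "\<lambda>v. of_real (V v) * \<psi> v" c]
  by (auto simp: schroedinger_dom_def mult_ac)

lemma dom_diff:
  assumes "\<psi> \<in> schroedinger_dom V" "\<phi> \<in> schroedinger_dom V"
  shows "(\<lambda>v. \<psi> v - \<phi> v) \<in> schroedinger_dom V"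
  using ell2_diff[OF domD(1)[OF assms(1)] domD(1)[OF assms(2)]]
    ell2_diff[OF domD(2)[OF assms(1)] domD(2)[OF assms(2)]]
  by (auto simp: schroedinger_dom_def right_diff_distrib)

lemma dom_cnj: "\<psi> \<in> schroedinger_dom V \<Longrightarrow> (\<lambda>v. cnj (\<psi> v)) \<in> schroedinger_dom V"
  using ell2_cnj[of \<psi>] ell2_cnj[of "\<lambda>v. of_real (V v) * \<psi> v"]
  by (auto simp: schroedinger_dom_def)

lemma dom_cutoff:
  assumes "\<psi> \<in> schroedinger_dom V"
  shows "cutoff S \<psi> \<in> schroedinger_dom V"
proof -
  have "(\<lambda>v. of_real (V v) * cutoff S \<psi> v) = cutoff S (\<lambda>v. of_real (V v) * \<psi> v)"
    by (auto simp: cutoff_def)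
  then show ?thesis
    using ell2_cutoff[OF domD(1)[OF assms]] ell2_cutoff[OF domD(2)[OF assms]]
    by (simp add: schroedinger_dom_def)
qed

lemma dom_finite_support:
  assumes "finite F" "\<And>v. v \<notin> F \<Longrightarrow> \<psi> v = 0"
  shows "\<psi> \<in> schroedinger_dom V"
  unfolding schroedinger_dom_def
  using ell2_finite_support[of F \<psi>] ell2_finite_support[of F "\<lambda>v. of_real (V v) * \<psi> v"] assms
  by auto

lemma schroedinger_add:
  "schroedinger E V (\<lambda>v. \<psi> v + \<phi> v) v = schroedinger E V \<psi> v + schroedinger E V \<phi> v"
  by (simp add: schroedinger_def sum.distrib algebra_simps)

lemma schroedinger_cmult:
  "schroedinger E V (\<lambda>v. c * \<psi> v) v = c * schroedinger E V \<psi> v"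
  by (simp add: schroedinger_def sum_distrib_left algebra_simps)

lemma schroedinger_diff:
  "schroedinger E V (\<lambda>v. \<psi> v - \<phi> v) v = schroedinger E V \<psi> v - schroedinger E V \<phi> v"
  by (simp add: schroedinger_def sum_subtractf algebra_simps)

lemma schroedinger_cnj:
  "schroedinger E V (\<lambda>v. cnj (\<psi> v)) v = cnj (schroedinger E V \<psi> v)"
  by (simp add: schroedinger_def)

text \<open>The operator theory works on any graph of bounded degree; the tree structure enters only
  through vertex sets with a sole exit.\<close>

locale schroedinger_graph =
  fixes E :: "'v \<Rightarrow> 'v \<Rightarrow> bool" and V :: "'v \<Rightarrow> real" and \<gamma> :: complex
  assumes adj_sym: "E v w \<Longrightarrow> E w v"
    and bounded_degree: "\<exists>K. \<forall>v. finite {w. E v w} \<and> card {w. E v w} \<le> K"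
    and Im_pos: "Im \<gamma> > 0"
begin

abbreviation H :: "('v \<Rightarrow> complex) \<Rightarrow> 'v \<Rightarrow> complex" where "H \<equiv> schroedinger E V"

abbreviation dom :: "('v \<Rightarrow> complex) set" where "dom \<equiv> schroedinger_dom V"

lemma finite_adj: "finite {w. E v w}"
  using bounded_degree by blast

text \<open>The oriented edges. Sums of the form \<open>\<Sum>\<^sub>v \<psi>(v) (A \<phi>)(v)\<close> are sums over this set, and the symmetry
  of the adjacency operator is its invariance under reversal of orientation.\<close>

definition edges :: "('v \<times> 'v) set" where "edges = (SIGMA v:UNIV. {w. E v w})"

lemma bij_swap_edges: "bij_betw prod.swap edges edges"
  by (rule bij_betw_byWitness[of _ prod.swap]) (auto simp: edges_def adj_sym)

lemma summable_fst_edges: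
  fixes g :: "'v \<Rightarrow> real"
  assumes "g summable_on UNIV" "\<And>v. g v \<ge> 0"
  shows "(\<lambda>p. g (fst p)) summable_on edges"
  unfolding edges_def
proof (rule summable_on_SigmaI)
  obtain K where card_nbrs: "\<And>v. card {w. E v w} \<le> K" using bounded_degree by blast
  show "((\<lambda>y. g (fst (x, y))) has_sum (of_nat (card {w. E x w}) * g x)) {w. E x w}" for x
    by (rule has_sum_finiteI) (auto simp: finite_adj)
  have "(\<lambda>x. real K * g x) summable_on UNIV"
    using assms(1) by (rule summable_on_cmult_right)
  then show "(\<lambda>x. of_nat (card {w. E x w}) * g x) summable_on UNIV"
    by (rule summable_on_comparison_test) (auto simp: assms card_nbrs intro!: mult_right_mono)
qed (use assms in auto)

lemma summable_snd_edges:
  fixes g :: "'v \<Rightarrow> real"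
  assumes "g summable_on UNIV" "\<And>v. g v \<ge> 0"
  shows "(\<lambda>p. g (snd p)) summable_on edges"
  using summable_on_reindex_bij_betw[OF bij_swap_edges, of "\<lambda>p. g (snd p)"] summable_fst_edges[OF assms]
  by simp

lemma ell2_adjacency:
  assumes "\<psi> \<in> ell2"
  shows "(\<lambda>v. \<Sum>w | E v w. \<psi> w) \<in> ell2"
proof -
  obtain K where card_nbrs: "\<And>v. card {w. E v w} \<le> K" using bounded_degree by blast
  show ?thesis
  proof (rule ell2_dominated)
    have "(\<lambda>p. (cmod (\<psi> (snd p)))\<^sup>2) summable_on edges"
      by (rule summable_snd_edges) (use assms in \<open>auto simp: ell2_def\<close>)
    then have "(\<lambda>v. infsum (\<lambda>w. (cmod (\<psi> (snd (v, w))))\<^sup>2) {w. E v w}) summable_on UNIV"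
      unfolding edges_def by (rule summable_on_SigmaD) (simp add: finite_adj summable_on_finite)
    then have "(\<lambda>v. \<Sum>w | E v w. (cmod (\<psi> w))\<^sup>2) summable_on UNIV"
      by (simp add: finite_adj)
    then show "(\<lambda>v. real K * (\<Sum>w | E v w. (cmod (\<psi> w))\<^sup>2)) summable_on UNIV"
      by (rule summable_on_cmult_right)
    fix v
    have "(cmod (\<Sum>w | E v w. \<psi> w))\<^sup>2 \<le> (\<Sum>w | E v w. cmod (\<psi> w))\<^sup>2"
      by (intro power_mono norm_sum) auto
    also have "\<dots> \<le> (\<Sum>w | E v w. (cmod (\<psi> w))\<^sup>2) * card {w. E v w}"
      by (rule sum_squared_le_sum_of_squares) 
    also have "\<dots> \<le> real K * (\<Sum>w | E v w. (cmod (\<psi> w))\<^sup>2)"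
      by (subst mult.commute, intro mult_right_mono) (auto simp: card_nbrs sum_nonneg)
    finally show "(cmod (\<Sum>w | E v w. \<psi> w))\<^sup>2 \<le> real K * (\<Sum>w | E v w. (cmod (\<psi> w))\<^sup>2)" .
  qed
qed

lemma adjacency_symmetric:
  assumes "\<psi> \<in> ell2" "\<phi> \<in> ell2"
  shows "(\<Sum>\<^sub>\<infinity>v. \<psi> v * (\<Sum>w | E v w. \<phi> w)) = (\<Sum>\<^sub>\<infinity>v. (\<Sum>w | E v w. \<psi> w) * \<phi> v)"
proof -
  have sq: "(\<lambda>p. (cmod (\<psi> (fst p)))\<^sup>2 + (cmod (\<phi> (snd p)))\<^sup>2) summable_on edges"
    by (intro summable_on_add summable_fst_edges[of "\<lambda>v. (cmod (\<psi> v))\<^sup>2"] summable_snd_edges[of "\<lambda>v. (cmod (\<phi> v))\<^sup>2"])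
       (use assms in \<open>auto simp: ell2_def\<close>)
  have "(\<lambda>p. norm (\<psi> (fst p) * \<phi> (snd p))) summable_on edges"
  proof (rule summable_on_comparison_test[OF sq])
    fix p
    show "norm (\<psi> (fst p) * \<phi> (snd p)) \<le> (cmod (\<psi> (fst p)))\<^sup>2 + (cmod (\<phi> (snd p)))\<^sup>2"
      using sum_squares_bound[of "cmod (\<psi> (fst p))" "cmod (\<phi> (snd p))"]
        mult_nonneg_nonneg[OF norm_ge_zero norm_ge_zero, of "\<psi> (fst p)" "\<phi> (snd p)"]
      unfolding norm_mult by linarith
  qed auto
  then have s: "(\<lambda>p. \<psi> (fst p) * \<phi> (snd p)) summable_on edges"
    by (rule abs_summable_summable)
  then have s': "(\<lambda>p. \<psi> (snd p) * \<phi> (fst p)) summable_on edges"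
    using summable_on_reindex_bij_betw[OF bij_swap_edges, of "\<lambda>p. \<psi> (fst p) * \<phi> (snd p)"]
    by simp
  have "(\<Sum>\<^sub>\<infinity>v. \<psi> v * (\<Sum>w | E v w. \<phi> w)) = infsum (\<lambda>p. \<psi> (fst p) * \<phi> (snd p)) edges"
    using infsum_Sigma_banach[OF s[unfolded edges_def]]
    by (simp add: edges_def finite_adj sum_distrib_left)
  also have "\<dots> = infsum (\<lambda>p. \<psi> (snd p) * \<phi> (fst p)) edges"
    using infsum_reindex_bij_betw[OF bij_swap_edges, of "\<lambda>p. \<psi> (fst p) * \<phi> (snd p)"]
    by simp
  also have "\<dots> = (\<Sum>\<^sub>\<infinity>v. (\<Sum>w | E v w. \<psi> w) * \<phi> v)"
    using infsum_Sigma_banach[OF s'[unfolded edges_def]]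
    by (simp add: edges_def finite_adj sum_distrib_right)
  finally show ?thesis .
qed

lemma schroedinger_symmetric:
  assumes "\<psi> \<in> dom" "\<phi> \<in> dom"
  shows "(\<Sum>\<^sub>\<infinity>v. \<psi> v * H \<phi> v) = (\<Sum>\<^sub>\<infinity>v. H \<psi> v * \<phi> v)"
proof -
  note d = domD[OF assms(1)] domD[OF assms(2)]
  have "(\<Sum>\<^sub>\<infinity>v. \<psi> v * H \<phi> v) =
      (\<Sum>\<^sub>\<infinity>v. \<psi> v * (\<Sum>w | E v w. \<phi> w)) + (\<Sum>\<^sub>\<infinity>v. \<psi> v * (of_real (V v) * \<phi> v))"
    unfolding schroedinger_def distrib_left
    by (intro infsum_add ell2_mult_summable ell2_adjacency d)
  also have "\<dots> = (\<Sum>\<^sub>\<infinity>v. (\<Sum>w | E v w. \<psi> w) * \<phi> v) + (\<Sum>\<^sub>\<infinity>v. of_real (V v) * \<psi> v * \<phi> v)"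
    by (simp add: adjacency_symmetric[OF d(1,3)] mult_ac)
  also have "\<dots> = (\<Sum>\<^sub>\<infinity>v. H \<psi> v * \<phi> v)"
    unfolding schroedinger_def distrib_right
    by (intro infsum_add[symmetric] ell2_mult_summable ell2_adjacency d)
  finally show ?thesis .
qed

section \<open>The Dirichlet problem on a set of vertices\<close>

text \<open>\<open>\<psi>\<close> solves the Dirichlet problem on \<open>S\<close> (zero outside \<open>S\<close>) with a source of strength \<open>c\<close> at
  \<open>x\<close>. For \<open>c = 1\<close> this characterises the column at \<open>x\<close> of the resolvent of the restriction of \<open>H\<close>
  to \<open>S\<close>.\<close>

definition point_source :: "'v set \<Rightarrow> 'v \<Rightarrow> complex \<Rightarrow> ('v \<Rightarrow> complex) \<Rightarrow> bool" where
  "point_source S x c \<psi> \<longleftrightarrow> \<psi> \<in> dom \<and> (\<forall>v. v \<notin> S \<longrightarrow> \<psi> v = 0) \<and>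
     (\<forall>v\<in>S. H \<psi> v - \<gamma> * \<psi> v = (if v = x then c else 0))"

text \<open>Pair the equation with \<open>\<psi>\<close> and take imaginary parts; \<open>\<langle>\<psi>, H\<psi>\<rangle>\<close> is real. Both uniqueness and
  the a priori bound come from this identity.\<close>

lemma energy_identity:
  assumes "point_source S x c \<psi>" "x \<in> S"
  shows "Im \<gamma> * (\<Sum>\<^sub>\<infinity>v. (cmod (\<psi> v))\<^sup>2) = - Im (cnj (\<psi> x) * c)"
proof -
  have dom: "\<psi> \<in> dom" and out: "\<And>v. v \<notin> S \<Longrightarrow> \<psi> v = 0"
    and eqn: "\<And>v. v \<in> S \<Longrightarrow> H \<psi> v - \<gamma> * \<psi> v = (if v = x then c else 0)"
    using assms(1) by (auto simp: point_source_def)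
  define Q where "Q = (\<Sum>\<^sub>\<infinity>v. cnj (\<psi> v) * H \<psi> v)"
  have "cnj Q = (\<Sum>\<^sub>\<infinity>v. \<psi> v * H (\<lambda>v. cnj (\<psi> v)) v)"
    by (simp add: Q_def infsum_cnj[symmetric] schroedinger_cnj)
  also have "\<dots> = (\<Sum>\<^sub>\<infinity>v. H \<psi> v * cnj (\<psi> v))"
    by (rule schroedinger_symmetric) (use dom dom_cnj in auto)
  also have "\<dots> = Q" by (simp add: Q_def mult_ac)
  finally have "Im Q = 0" by (metis Reals_cnj_iff complex_is_Real_iff)
  have sm: "(\<lambda>v. (cmod (\<psi> v))\<^sup>2) summable_on UNIV" using domD(1)[OF dom] by (simp add: ell2_def)
  have "cnj (\<psi> v) * H \<psi> v = \<gamma> * of_real ((cmod (\<psi> v))\<^sup>2) + (if v = x then cnj (\<psi> x) * c else 0)" for v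
  proof (cases "v \<in> S")
    case True
    have "cnj (\<psi> v) * H \<psi> v = \<gamma> * (\<psi> v * cnj (\<psi> v)) + cnj (\<psi> v) * (H \<psi> v - \<gamma> * \<psi> v)"
      by (simp add: algebra_simps)
    then show ?thesis
      by (simp add: eqn True complex_norm_square[symmetric])
  qed (use out assms(2) in auto)
  then have "Q = (\<Sum>\<^sub>\<infinity>v. \<gamma> * of_real ((cmod (\<psi> v))\<^sup>2) + (if v = x then cnj (\<psi> x) * c else 0))"
    by (simp add: Q_def)
  also have "\<dots> = (\<Sum>\<^sub>\<infinity>v. \<gamma> * of_real ((cmod (\<psi> v))\<^sup>2)) + (\<Sum>\<^sub>\<infinity>v. if v = x then cnj (\<psi> x) * c else 0)"
  proof (rule infsum_add)
    show "(\<lambda>v. \<gamma> * of_real ((cmod (\<psi> v))\<^sup>2)) summable_on UNIV"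
      by (intro summable_on_cmult_right summable_on_of_real sm)
    show "(\<lambda>v. if v = x then cnj (\<psi> x) * c else 0) summable_on UNIV"
      by (rule summable_on_delta)
  qed
  also have "\<dots> = \<gamma> * of_real (\<Sum>\<^sub>\<infinity>v. (cmod (\<psi> v))\<^sup>2) + cnj (\<psi> x) * c"
  proof -
    have "(\<Sum>\<^sub>\<infinity>v. (of_real ((cmod (\<psi> v))\<^sup>2) :: complex)) = of_real (\<Sum>\<^sub>\<infinity>v. (cmod (\<psi> v))\<^sup>2)"
      by (intro infsumI has_sum_of_real has_sum_infsum sm)
    then show ?thesis
      using summable_on_of_real[OF sm, where 'a = complex]
      by (subst infsum_cmult_right) (auto simp: infsum_delta)
  qed
  finally show ?thesis using \<open>Im Q = 0\<close> by simp
qed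

lemma ell2_norm_zero:
  assumes "\<psi> \<in> ell2" "(\<Sum>\<^sub>\<infinity>v. (cmod (\<psi> v))\<^sup>2) \<le> 0"
  shows "\<psi> = (\<lambda>_. 0)"
proof
  fix v
  have "(cmod (\<psi> v))\<^sup>2 = 0"
    by (rule nonneg_infsum_le_0D[OF assms(2)]) (use assms(1) in \<open>auto simp: ell2_def\<close>)
  then show "\<psi> v = 0" by simp
qed

lemma point_source_dom: "point_source S x c \<psi> \<Longrightarrow> \<psi> \<in> dom"
  by (simp add: point_source_def)

text \<open>If \<open>\<psi>\<close> vanished at its own source, its energy would be zero.\<close>

lemma point_source_nonzero:
  assumes "point_source S x c \<psi>" "x \<in> S" "c \<noteq> 0"
  shows "\<psi> x \<noteq> 0"
proof
  assume "\<psi> x = 0"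
  then have "(\<Sum>\<^sub>\<infinity>v. (cmod (\<psi> v))\<^sup>2) = 0"
    using energy_identity[OF assms(1,2)] Im_pos by simp
  then have "\<psi> = (\<lambda>_. 0)"
    using ell2_norm_zero domD(1) point_source_dom[OF assms(1)] by fastforce
  then show False using assms by (auto simp: point_source_def schroedinger_def)
qed

lemma point_source_zero:
  assumes "point_source S x 0 \<psi>" "x \<in> S"
  shows "\<psi> = (\<lambda>_. 0)"
proof -
  have "(\<Sum>\<^sub>\<infinity>v. (cmod (\<psi> v))\<^sup>2) = 0"
    using energy_identity[OF assms] Im_pos by simp
  then show ?thesis
    using ell2_norm_zero domD(1) point_source_dom[OF assms(1)] by fastforce
qed

lemma point_source_proportional:
  assumes "point_source S x c \<psi>" "point_source S x d \<phi>" "x \<in> S"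
  shows "d * \<psi> v = c * \<phi> v"
proof -
  have "point_source S x 0 (\<lambda>v. d * \<psi> v - c * \<phi> v)"
    unfolding point_source_def schroedinger_diff schroedinger_cmult
  proof (intro conjI allI ballI impI)
    show "(\<lambda>v. d * \<psi> v - c * \<phi> v) \<in> dom"
      using assms by (intro dom_diff dom_cmult point_source_dom)
    show "d * \<psi> v - c * \<phi> v = 0" if "v \<notin> S" for v
      using assms that by (simp add: point_source_def)
    fix v assume "v \<in> S"
    have "d * H \<psi> v - c * H \<phi> v - \<gamma> * (d * \<psi> v - c * \<phi> v)
        = d * (H \<psi> v - \<gamma> * \<psi> v) - c * (H \<phi> v - \<gamma> * \<phi> v)"
      by (simp add: algebra_simps)
    then show "d * H \<psi> v - c * H \<phi> v - \<gamma> * (d * \<psi> v - c * \<phi> v) = (if v = x then 0 else 0)"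
      using assms \<open>v \<in> S\<close> by (simp add: point_source_def)
  qed
  from point_source_zero[OF this assms(3)] show ?thesis by (metis eq_iff_diff_eq_0)
qed

text \<open>Induction on \<open>F\<close> by elimination of one vertex. The solution on \<open>F\<close> is corrected by a multiple of
  a function \<open>\<theta>\<close> with \<open>\<theta>(x) = 1\<close> that solves the homogeneous equation on \<open>F\<close>. The pivot \<open>s\<close>, the
  value of \<open>(H - \<gamma>) \<theta>\<close> at \<open>x\<close>, is not zero: otherwise \<open>\<theta>\<close> would be a nonzero solution of the
  homogeneous problem on the larger set.\<close>

lemma finite_dirichlet_solvable:
  assumes "finite F"
  shows "\<exists>\<psi>. (\<forall>v. v \<notin> F \<longrightarrow> \<psi> v = 0) \<and> (\<forall>v\<in>F. H \<psi> v - \<gamma> * \<psi> v = \<phi> v)"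
  using assms
proof (induction F arbitrary: \<phi> rule: finite_induct)
  case empty
  show ?case by auto
next
  case (insert x F)
  obtain \<psi>0 where \<psi>0: "\<And>v. v \<notin> F \<Longrightarrow> \<psi>0 v = 0" "\<And>v. v \<in> F \<Longrightarrow> H \<psi>0 v - \<gamma> * \<psi>0 v = \<phi> v"
    using insert.IH[of \<phi>] by blast
  obtain \<eta> where \<eta>: "\<And>v. v \<notin> F \<Longrightarrow> \<eta> v = 0"
      "\<And>v. v \<in> F \<Longrightarrow> H \<eta> v - \<gamma> * \<eta> v = - H (delta_fun x) v"
    using insert.IH[of "\<lambda>v. - H (delta_fun x) v"] by blast
  define \<theta> where "\<theta> = (\<lambda>v. delta_fun x v + \<eta> v)"
  define s where "s = H \<theta> x - \<gamma> * \<theta> x"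
  have \<theta>F: "H \<theta> v - \<gamma> * \<theta> v = 0" if "v \<in> F" for v
  proof -
    have "delta_fun x v = 0" using that insert.hyps by (auto simp: delta_fun_def)
    then show ?thesis using \<eta>(2)[OF that] by (simp add: \<theta>_def schroedinger_add algebra_simps)
  qed
  have \<theta>x: "\<theta> x = 1" using \<eta>(1) insert.hyps by (simp add: \<theta>_def delta_fun_def)
  have \<theta>out: "\<theta> v = 0" if "v \<notin> insert x F" for v
    using that \<eta>(1) by (auto simp: \<theta>_def delta_fun_def)
  have ps: "point_source (insert x F) x s \<theta>"
    unfolding point_source_def
    using \<theta>F \<theta>out insert.hyps dom_finite_support[of "insert x F" \<theta>] by (auto simp: s_def)
  have "s \<noteq> 0"
    using point_source_zero[of "insert x F" x \<theta>] ps \<theta>x by auto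
  define a where "a = (\<phi> x - (H \<psi>0 x - \<gamma> * \<psi>0 x)) / s"
  define \<psi> where "\<psi> = (\<lambda>v. \<psi>0 v + a * \<theta> v)"
  have H\<psi>: "H \<psi> v - \<gamma> * \<psi> v = (H \<psi>0 v - \<gamma> * \<psi>0 v) + a * (H \<theta> v - \<gamma> * \<theta> v)" for v
    unfolding \<psi>_def schroedinger_add schroedinger_cmult by (simp add: algebra_simps)
  show ?case
  proof (intro exI[of _ \<psi>] conjI allI ballI impI)
    fix v assume "v \<notin> insert x F"
    then show "\<psi> v = 0" using \<psi>0(1) \<theta>out by (auto simp: \<psi>_def)
  next
    fix v assume "v \<in> insert x F"
    then consider "v = x" | "v \<in> F" by auto
    then show "H \<psi> v - \<gamma> * \<psi> v = \<phi> v"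
    proof cases
      case 1
      have "a * s = \<phi> x - (H \<psi>0 x - \<gamma> * \<psi>0 x)" using \<open>s \<noteq> 0\<close> by (simp add: a_def)
      then show ?thesis using 1 H\<psi>[of x] by (simp add: s_def[symmetric])
    next
      case 2
      then show ?thesis using H\<psi>[of v] \<psi>0(2) \<theta>F by simp
    qed
  qed
qed

lemma compact_polydisc: "compact (Pi UNIV (\<lambda>v::'v. cball (0::complex) r))"
proof -
  have "compactin (product_topology (\<lambda>v::'v. euclidean) UNIV) (PiE UNIV (\<lambda>v. cball (0::complex) r))"
    by (subst compactin_PiE) auto
  then show ?thesis
    by (simp only: euclidean_product_topology PiE_UNIV_domain compactin_euclidean_iff)
qed

lemma continuous_on_schroedinger: "continuous_on UNIV (\<lambda>\<psi>. H \<psi> v)"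
  unfolding schroedinger_def
  by (intro continuous_intros continuous_on_product_coordinates)

text \<open>The finite Dirichlet problems have solutions with \<open>\<ell>\<^sup>2\<close>-norm at most \<open>1 / Im \<gamma>\<close>. For finite \<open>F\<close> let
  \<open>X F\<close> be the set of functions satisfying the equation, the Dirichlet condition and this bound on
  \<open>F\<close>. These sets are closed for pointwise convergence and have the finite intersection property
  inside a product of discs, so by Tychonoff's theorem they have a common point. The bound makes the
  limit square-summable. The equation expresses \<open>V \<psi>\<close> through \<open>\<psi>\<close> and the bounded adjacency operator,
  so the limit lies in the domain.\<close>

lemma dirichlet_solution_exists:
  assumes "u \<in> S"
  shows "\<exists>\<psi>. point_source S u 1 \<psi>"
proof -
  define r where "r = 1 / Im \<gamma>"
  have "r > 0" using Im_pos by (simp add: r_def)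
  define box where "box = Pi UNIV (\<lambda>v::'v. cball (0::complex) r)"
  define X where "X F = {\<psi>. (\<forall>v\<in>F \<inter> S. H \<psi> v - \<gamma> * \<psi> v = (if v = u then 1 else 0)) \<and>
      (\<forall>v\<in>F - S. \<psi> v = 0) \<and> (\<Sum>v\<in>F. (cmod (\<psi> v))\<^sup>2) \<le> r\<^sup>2}" for F
  have closed: "closed (X F)" if "finite F" for F
    unfolding X_def Ball_def
    by (intro closed_Collect_conj closed_Collect_all closed_Collect_imp open_Collect_const
        closed_Collect_eq closed_Collect_le
        continuous_intros continuous_on_product_coordinates continuous_on_schroedinger)
  have nonempty: "\<exists>\<psi>. \<psi> \<in> box \<and> \<psi> \<in> X F" if F: "finite F" for F
  proof -
    define F' where "F' = insert u (F \<inter> S)"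
    have F': "finite F'" "u \<in> F'" using F by (auto simp: F'_def)
    obtain \<psi> where \<psi>: "\<And>v. v \<notin> F' \<Longrightarrow> \<psi> v = 0"
        "\<And>v. v \<in> F' \<Longrightarrow> H \<psi> v - \<gamma> * \<psi> v = (if v = u then 1 else 0)"
      using finite_dirichlet_solvable[OF F'(1), of "\<lambda>v. if v = u then 1 else 0"] by blast
    have ps: "point_source F' u 1 \<psi>"
      unfolding point_source_def using \<psi> dom_finite_support[OF F'(1)] by auto
    have "(\<Sum>\<^sub>\<infinity>v. (cmod (\<psi> v))\<^sup>2) = (\<Sum>\<^sub>\<infinity>v\<in>F'. (cmod (\<psi> v))\<^sup>2)"
      by (rule infsum_cong_neutral) (use \<psi>(1) in auto)
    also have "\<dots> = (\<Sum>v\<in>F'. (cmod (\<psi> v))\<^sup>2)"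
      using F'(1) by (rule infsum_finite)
    finally have "Im \<gamma> * (\<Sum>v\<in>F'. (cmod (\<psi> v))\<^sup>2) = Im (\<psi> u)"
      using energy_identity[OF ps F'(2)] by simp
    then have sum_eq: "(\<Sum>v\<in>F'. (cmod (\<psi> v))\<^sup>2) = r * Im (\<psi> u)"
      using Im_pos by (simp add: r_def field_simps)
    also have "\<dots> \<le> r * cmod (\<psi> u)"
      using \<open>r > 0\<close> abs_Im_le_cmod[of "\<psi> u"] by (intro mult_left_mono) auto
    finally have sum_le: "(\<Sum>v\<in>F'. (cmod (\<psi> v))\<^sup>2) \<le> r * cmod (\<psi> u)" .
    have pt: "(cmod (\<psi> v))\<^sup>2 \<le> (\<Sum>v\<in>F'. (cmod (\<psi> v))\<^sup>2)" for v
      by (cases "v \<in> F'") (auto simp: \<psi>(1) F'(1) sum_nonneg intro: member_le_sum)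
    have "cmod (\<psi> u) * cmod (\<psi> u) \<le> r * cmod (\<psi> u)"
      using pt[of u] sum_le by (simp add: power2_eq_square)
    then have "cmod (\<psi> u) \<le> r"
      using point_source_nonzero[OF ps F'(2)] by simp
    then have "r * cmod (\<psi> u) \<le> r\<^sup>2"
      using \<open>r > 0\<close> by (simp add: power2_eq_square)
    with sum_le have bound: "(\<Sum>v\<in>F'. (cmod (\<psi> v))\<^sup>2) \<le> r\<^sup>2"
      by linarith
    have "cmod (\<psi> v) \<le> r" for v
      using pt[of v] bound \<open>r > 0\<close> by (meson dual_order.trans less_imp_le power2_le_imp_le)
    then have "\<psi> \<in> box" by (simp add: box_def)
    have "(\<Sum>v\<in>F. (cmod (\<psi> v))\<^sup>2) = (\<Sum>v\<in>F \<inter> F'. (cmod (\<psi> v))\<^sup>2)"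
      by (rule sum.mono_neutral_right) (use F \<psi>(1) in auto)
    also have "\<dots> \<le> (\<Sum>v\<in>F'. (cmod (\<psi> v))\<^sup>2)"
      by (rule sum_mono2) (use F'(1) in auto)
    finally have le: "(\<Sum>v\<in>F. (cmod (\<psi> v))\<^sup>2) \<le> r\<^sup>2" using bound by linarith
    have "\<psi> v = 0" if "v \<in> F - S" for v
      by (rule \<psi>(1)) (use that assms in \<open>auto simp: F'_def\<close>)
    moreover have "H \<psi> v - \<gamma> * \<psi> v = (if v = u then 1 else 0)" if "v \<in> F \<inter> S" for v
      by (rule \<psi>(2)) (use that in \<open>auto simp: F'_def\<close>)
    ultimately have "\<psi> \<in> X F" using le unfolding X_def by blast
    with \<open>\<psi> \<in> box\<close> show ?thesis by blast
  qed
  have "box \<inter> (\<Inter>F\<in>{F. finite F}. X F) \<noteq> {}"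
  proof (rule compact_imp_fip_image)
    show "compact box" unfolding box_def by (rule compact_polydisc)
    show "closed (X F)" if "F \<in> {F. finite F}" for F using closed that by simp
    fix I' assume I': "finite I'" "I' \<subseteq> {F :: 'v set. finite F}"
    then have "finite (\<Union>I')" by auto
    then obtain \<psi> where \<psi>: "\<psi> \<in> box" "\<psi> \<in> X (\<Union>I')" using nonempty by blast
    have "\<psi> \<in> X F" if "F \<in> I'" for F
    proof -
      have "(\<Sum>v\<in>F. (cmod (\<psi> v))\<^sup>2) \<le> (\<Sum>v\<in>\<Union>I'. (cmod (\<psi> v))\<^sup>2)"
        by (rule sum_mono2) (use \<open>finite (\<Union>I')\<close> that in auto)
      moreover have "(\<Sum>v\<in>\<Union>I'. (cmod (\<psi> v))\<^sup>2) \<le> r\<^sup>2" using \<psi>(2) by (simp add: X_def)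
      ultimately have "(\<Sum>v\<in>F. (cmod (\<psi> v))\<^sup>2) \<le> r\<^sup>2" by linarith
      moreover have "\<forall>v\<in>F \<inter> S. H \<psi> v - \<gamma> * \<psi> v = (if v = u then 1 else 0)" "\<forall>v\<in>F - S. \<psi> v = 0"
        using \<psi>(2) that unfolding X_def by blast+
      ultimately show ?thesis unfolding X_def by blast
    qed
    then show "box \<inter> (\<Inter>F\<in>I'. X F) \<noteq> {}" using \<psi>(1) by blast
  qed
  then obtain \<psi> where X: "\<And>F. finite F \<Longrightarrow> \<psi> \<in> X F" by blast
  have eqn: "H \<psi> v - \<gamma> * \<psi> v = (if v = u then 1 else 0)" if "v \<in> S" for v
    using X[of "{v}"] that by (auto simp: X_def)
  have out: "\<psi> v = 0" if "v \<notin> S" for v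
    using X[of "{v}"] that by (auto simp: X_def)
  have "\<psi> \<in> ell2"
    unfolding ell2_def mem_Collect_eq
    by (rule nonneg_bdd_above_summable_on) (use X in \<open>auto simp: X_def bdd_above_def\<close>)
  \<comment> \<open>\<open>V \<psi>\<close> as given by the equation on \<open>S\<close>; outside \<open>S\<close> both sides vanish\<close>
  let ?\<phi> = "\<lambda>v. cutoff S (delta_fun u) v + (\<gamma> * \<psi> v - cutoff S (\<lambda>v. \<Sum>w | E v w. \<psi> w) v)"
  have "?\<phi> \<in> ell2"
    by (intro ell2_add ell2_diff ell2_cmult ell2_cutoff ell2_adjacency \<open>\<psi> \<in> ell2\<close>
        ell2_finite_support[of "{u}"]) (auto simp: delta_fun_def)
  moreover have "of_real (V v) * \<psi> v = ?\<phi> v" for v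
    using eqn[of v] out[of v]
    by (auto simp: cutoff_def delta_fun_def schroedinger_def algebra_simps split: if_splits)
  ultimately have "\<psi> \<in> dom" using \<open>\<psi> \<in> ell2\<close> by (simp add: schroedinger_dom_def)
  then show ?thesis using eqn out unfolding point_source_def by blast
qed

section \<open>Green functions\<close>

definition green_on :: "'v set \<Rightarrow> 'v \<Rightarrow> 'v \<Rightarrow> complex" where
  "green_on S x u = resolvent_entry (schroedinger_on S E V) (schroedinger_on_dom S V) \<gamma> u x"

text \<open>Outside \<open>S\<close> the restricted operator vanishes, so the resolvent equation reads \<open>- \<gamma> \<psi>(v) = 0\<close>
  there and forces the Dirichlet condition, as \<open>\<gamma> \<noteq> 0\<close>.\<close>

lemma resolvent_eqn_iff_point_source:
  assumes "x \<in> S"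
  shows "\<psi> \<in> schroedinger_on_dom S V \<and> (\<lambda>v. schroedinger_on S E V \<psi> v - \<gamma> * \<psi> v) = delta_fun x
     \<longleftrightarrow> point_source S x 1 \<psi>" (is "?L \<longleftrightarrow> ?R")
proof
  assume L: ?L
  then have eqn: "schroedinger_on S E V \<psi> v - \<gamma> * \<psi> v = delta_fun x v" for v
    using fun_cong[of "\<lambda>v. schroedinger_on S E V \<psi> v - \<gamma> * \<psi> v" "delta_fun x" v] by blast
  have out: "\<psi> v = 0" if "v \<notin> S" for v
  proof -
    have "- (\<gamma> * \<psi> v) = 0"
      using eqn[of v] that assms unfolding schroedinger_on_def cutoff_def delta_fun_def by auto
    then show ?thesis using Im_pos by auto
  qed
  then have cut: "cutoff S \<psi> = \<psi>" by (auto simp: cutoff_def)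
  have "H \<psi> v - \<gamma> * \<psi> v = (if v = x then 1 else 0)" if "v \<in> S" for v
    using eqn[of v] that unfolding schroedinger_on_def cut by (simp add: cutoff_def delta_fun_def)
  moreover have "\<psi> \<in> dom" using L by (simp add: schroedinger_on_dom_def cut)
  ultimately show ?R using out by (simp add: point_source_def)
next
  assume R: ?R
  then have cut: "cutoff S \<psi> = \<psi>" by (auto simp: cutoff_def point_source_def)
  have "schroedinger_on S E V \<psi> v - \<gamma> * \<psi> v = delta_fun x v" for v
    using R assms unfolding schroedinger_on_def cut
    by (cases "v \<in> S") (auto simp: cutoff_def delta_fun_def point_source_def)
  then show ?L
    using point_source_dom[OF R] domD(1)[OF point_source_dom[OF R]]
    by (simp add: schroedinger_on_dom_def cut fun_eq_iff)
qed

lemma green_on_point_source: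
  assumes "x \<in> S"
  shows "point_source S x 1 (green_on S x)"
proof -
  define D where "D = schroedinger_on_dom S V"
  define T where "T = (\<lambda>\<psi> v. schroedinger_on S E V \<psi> v - \<gamma> * \<psi> v)"
  have iff: "\<psi> \<in> D \<and> T \<psi> = delta_fun x \<longleftrightarrow> point_source S x 1 \<psi>" for \<psi>
    using resolvent_eqn_iff_point_source[OF assms] by (simp add: D_def T_def)
  obtain \<psi> where "\<psi> \<in> D" "T \<psi> = delta_fun x"
    using dirichlet_solution_exists[OF assms] iff by blast
  then have "delta_fun x \<in> T ` D" by (metis imageI)
  then have "point_source S x 1 (inv_into D T (delta_fun x))"
    using iff f_inv_into_f[of "delta_fun x" T D] inv_into_into[of "delta_fun x" T D] by blast
  moreover have "green_on S x = inv_into D T (delta_fun x)"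
    by (rule ext) (simp add: green_on_def resolvent_entry_def ell2_inner_delta D_def T_def)
  ultimately show ?thesis by simp
qed

lemma green_on_diag_nonzero: "x \<in> S \<Longrightarrow> green_on S x x \<noteq> 0"
  using point_source_nonzero[OF green_on_point_source] by simp

lemma point_source_eq_green_on:
  assumes "point_source S x c \<psi>" "x \<in> S"
  shows "\<psi> v = c * green_on S x v"
  using point_source_proportional[OF assms(1) green_on_point_source[OF assms(2)] assms(2)] by simp

abbreviation G :: "'v \<Rightarrow> 'v \<Rightarrow> complex" where "G u v \<equiv> green E V \<gamma> u v"

lemma green_eq_green_on_UNIV: "G u v = green_on UNIV v u"
proof -
  have cut: "cutoff UNIV \<psi> = \<psi>" for \<psi> :: "'v \<Rightarrow> complex" by (simp add: cutoff_def fun_eq_iff)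
  have "schroedinger_on UNIV E V = H"
    by (rule ext) (simp add: schroedinger_on_def cut)
  moreover have "schroedinger_on_dom UNIV V = dom"
    by (auto simp: schroedinger_on_dom_def schroedinger_dom_def cut)
  ultimately show ?thesis by (simp add: green_def green_on_def)
qed

lemma green_point_source: "point_source UNIV x 1 (\<lambda>v. G v x)"
  unfolding green_eq_green_on_UNIV by (rule green_on_point_source) simp

lemma green_eqn: "H (\<lambda>v. G v x) u = \<gamma> * G u x + (if u = x then 1 else 0)"
  using green_point_source[of x] by (simp add: point_source_def algebra_simps)

lemma green_dom: "(\<lambda>v. G v x) \<in> dom"
  using green_point_source point_source_dom by blast

lemma green_diag_nonzero: "G x x \<noteq> 0"
  using point_source_nonzero[OF green_point_source] by simp

lemma infsum_green_pairing:
  "(\<Sum>\<^sub>\<infinity>x. G x u * H (\<lambda>x. G x v) x) = (\<Sum>\<^sub>\<infinity>x. \<gamma> * (G x u * G x v)) + G v u"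
proof -
  have "(\<lambda>x. G x u * G x v) summable_on UNIV"
    by (intro ell2_mult_summable domD(1)[OF green_dom])
  then have sm: "(\<lambda>x. \<gamma> * (G x u * G x v)) summable_on UNIV" by (rule summable_on_cmult_right)
  have "(\<Sum>\<^sub>\<infinity>x. G x u * H (\<lambda>x. G x v) x)
      = (\<Sum>\<^sub>\<infinity>x. \<gamma> * (G x u * G x v) + (if x = v then G x u else 0))"
    by (intro infsum_cong) (simp only: green_eqn, simp add: distrib_left)
  also have "\<dots> = (\<Sum>\<^sub>\<infinity>x. \<gamma> * (G x u * G x v)) + G v u"
    by (subst infsum_add[OF sm summable_on_delta]) (simp only: infsum_delta)
  finally show ?thesis .
qed

text \<open>Evaluate \<open>\<langle>G(\<cdot>,u), H G(\<cdot>,v)\<rangle>\<close> (bilinear pairing) by letting \<open>H\<close> act on either factor.\<close>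

lemma green_symmetric: "G u v = G v u"
proof -
  have "(\<Sum>\<^sub>\<infinity>x. G x u * H (\<lambda>x. G x v) x) = (\<Sum>\<^sub>\<infinity>x. G x v * H (\<lambda>x. G x u) x)"
    using schroedinger_symmetric[OF green_dom green_dom, of u v] by (simp only: mult.commute)
  moreover have "(\<Sum>\<^sub>\<infinity>x. \<gamma> * (G x u * G x v)) = (\<Sum>\<^sub>\<infinity>x. \<gamma> * (G x v * G x u))"
    by (simp only: mult.commute)
  ultimately show ?thesis using infsum_green_pairing[of u v] infsum_green_pairing[of v u] by simp
qed

lemma schroedinger_cutoff:
  assumes "sole_exit E S x c" "v \<in> S"
  shows "H (cutoff S \<psi>) v = H \<psi> v - (if v = x then \<psi> c else 0)"
proof -
  have edge: "E x c" and "c \<notin> S" using sole_exitD[OF assms(1)] by blast+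
  have "w \<notin> S \<longleftrightarrow> v = x \<and> w = c" if "E v w" for w
    using assms that unfolding sole_exit_def by blast
  then have "cutoff S \<psi> w = \<psi> w - (if v = x \<and> w = c then \<psi> c else 0)" if "E v w" for w
    using that \<open>c \<notin> S\<close> unfolding cutoff_def by auto
  then have "(\<Sum>w | E v w. cutoff S \<psi> w) = (\<Sum>w | E v w. \<psi> w - (if v = x \<and> w = c then \<psi> c else 0))"
    by (intro sum.cong) auto
  also have "\<dots> = (\<Sum>w | E v w. \<psi> w) - (if v = x then \<psi> c else 0)"
    using edge by (cases "v = x") (simp_all add: sum_subtractf finite_adj)
  finally show ?thesis using assms(2) by (simp add: schroedinger_def cutoff_def)
qed

text \<open>Cutting \<open>G(\<cdot>,s)\<close> off outside \<open>S\<close> removes only the contribution of \<open>c\<close> to the equation at \<open>x\<close>,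
  which turns into a point source. If \<open>s = x\<close> it is added to the source of \<open>G(\<cdot>,x)\<close>.\<close>

lemma green_cutoff_point_source:
  assumes "sole_exit E S x c" "s = x \<or> s \<notin> S"
  shows "point_source S x ((if s = x then 1 else 0) - G c s) (cutoff S (\<lambda>v. G v s))"
  unfolding point_source_def
proof (intro conjI ballI allI impI)
  show "cutoff S (\<lambda>v. G v s) \<in> dom" by (intro dom_cutoff green_dom)
  show "cutoff S (\<lambda>v. G v s) v = 0" if "v \<notin> S" for v using that by (simp add: cutoff_def)
  fix v assume v: "v \<in> S"
  then have "v = s \<longleftrightarrow> v = x \<and> s = x" using assms(2) by auto
  then show "H (cutoff S (\<lambda>v. G v s)) v - \<gamma> * cutoff S (\<lambda>v. G v s) v
      = (if v = x then (if s = x then 1 else 0) - G c s else 0)"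
    unfolding schroedinger_cutoff[OF assms(1) v] green_eqn using v by (auto simp: cutoff_def)
qed

lemma green_across_cut:
  assumes "sole_exit E S x c" "s \<notin> S" "v \<in> S"
  shows "G v s = - G c s * green_on S x v"
proof -
  note x = sole_exitD(2)[OF assms(1)]
  then have "s \<noteq> x" using assms(2) by auto
  then show ?thesis
    using point_source_eq_green_on[OF green_cutoff_point_source[OF assms(1), of s] x, of v] assms(2,3)
    by (simp add: cutoff_def)
qed

lemma green_at_cut:
  assumes "sole_exit E S x c"
  shows "G x x = (1 - G c x) * green_on S x x"
proof -
  note x = sole_exitD(2)[OF assms(1)]
  then show ?thesis
    using point_source_eq_green_on[OF green_cutoff_point_source[OF assms, of x] x, of x]
    by (simp add: cutoff_def)
qed

text \<open>On \<open>S\<close> both \<open>G(\<cdot>,s)\<close> and \<open>G(\<cdot>,c)\<close> are multiples of one function, with coefficients \<open>- G(c,s)\<close>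
  and \<open>- G(c,c)\<close>.\<close>

lemma green_ratio_across_cut:
  assumes "sole_exit E S x c" "s \<notin> S" "v \<in> S"
  shows "G v s * G c c = G v c * G c s"
proof -
  note c = sole_exitD(3)[OF assms(1)]
  show ?thesis
    using green_across_cut[OF assms] green_across_cut[OF assms(1) c assms(3)] by simp
qed

end

section \<open>Green functions and the Poisson kernel of a tree\<close>

locale schroedinger_tree = graph_tree E orig + schroedinger_graph E V \<gamma>
  for E :: "'v \<Rightarrow> 'v \<Rightarrow> bool" and orig :: 'v and V :: "'v \<Rightarrow> real" and \<gamma> :: complex
begin

abbreviation \<zeta> :: "'v \<Rightarrow> 'v \<Rightarrow> complex" where "\<zeta> u w \<equiv> zeta E V \<gamma> u w"

lemma zeta_eq: "\<zeta> u w = - green_on (cut_tree E w u) w w"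
  by (simp add: zeta_def green_cut_def green_on_def)

lemma green_step:
  assumes "E u w" "s \<notin> cut_tree E w u"
  shows "G w s = \<zeta> u w * G u s"
proof -
  have ex: "sole_exit E (cut_tree E w u) w u" by (rule cut_tree_sole_exit[OF edge_sym[OF assms(1)]])
  from green_across_cut[OF ex assms(2) sole_exitD(2)[OF ex]] show ?thesis by (simp add: zeta_eq)
qed

text \<open>The counterpart of \<open>green_step\<close> for \<open>s = w\<close>, where the difference does not vanish; it
  produces the one surviving term in the boundary values.\<close>

lemma green_step_diag:
  assumes "E u w"
  shows "G w w - \<zeta> u w * G u w = - \<zeta> u w"
  using green_at_cut[OF cut_tree_sole_exit[OF edge_sym[OF assms]]] by (simp add: zeta_eq algebra_simps)

lemma zeta_nonzero: "E u w \<Longrightarrow> \<zeta> u w \<noteq> 0"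
  using sole_exitD(2)[OF cut_tree_sole_exit[OF edge_sym]] green_on_diag_nonzero by (simp add: zeta_eq)

text \<open>The arc from the origin, which is outside the branch, could enter the branch only through \<open>w\<close>.
  Only the endpoint \<open>s\<close> of the arc can have a level as large as that of \<open>w\<close>, and \<open>s \<noteq> w\<close>.\<close>

lemma notin_branch_of_same_level:
  assumes "E u w" "lev w = Suc (lev u)" "lev s \<le> lev w" "s \<noteq> w"
  shows "s \<notin> cut_tree E w u"
proof -
  have ex: "sole_exit E (cut_tree E w u) w u" by (rule cut_tree_sole_exit[OF edge_sym[OF assms(1)]])
  have "u \<in> set (arc w orig)"
    using arc_up[OF assms(1,2)] arc_last[of orig u] arc_nonempty[of orig u] unfolding arc_rev[of w orig]
    by (metis Un_iff last_in_set set_append set_rev)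
  then have o: "orig \<notin> cut_tree E w u" by (simp add: cut_tree_def)
  have "arc orig s ! lev s \<notin> cut_tree E w u"
  proof (rule sole_exit_walk_outside[OF ex, of 0])
    show "arc orig s ! 0 \<notin> cut_tree E w u" using o by (simp add: arc_nth_0)
    show "E (arc orig s ! k) (arc orig s ! Suc k)" if "k < lev s" for k
      using that by (rule arc_nth_edge)
    show "arc orig s ! k \<noteq> w" if "k \<le> lev s" for k
      using lev_arc_nth[OF that] arc_nth_last[of s] assms(3,4) that by (metis le_antisym)
  qed simp
  then show ?thesis by (simp add: arc_nth_last)
qed

lemma orig_notin_branch:
  assumes "E u w" "lev w = Suc (lev u)"
  shows "orig \<notin> cut_tree E w u"
proof (rule notin_branch_of_same_level[OF assms])
  show "orig \<noteq> w" using assms(2) lev_orig by (metis nat.distinct(1))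
qed (simp add: lev_orig)

lemma green_orig_step:
  assumes "E u w" "lev w = Suc (lev u)"
  shows "G orig w = \<zeta> u w * G orig u"
  using green_step[OF assms(1) orig_notin_branch[OF assms]] by (simp add: green_symmetric[of orig])

text \<open>Along an arc from the origin \<open>G(o,\<cdot>)\<close> is multiplied by a nonzero \<open>\<zeta>\<close> at each step.\<close>

lemma green_orig_nonzero: "G orig v \<noteq> 0"
proof (induction "lev v" arbitrary: v)
  case 0
  then have "v = orig" using lev_eq_0 by simp
  then show ?case using green_diag_nonzero by simp
next
  case (Suc n)
  then have "v \<noteq> orig" using lev_orig by auto
  then obtain u where "E u v" "lev v = Suc (lev u)" using parent_exists by blast
  then show ?case using green_orig_step zeta_nonzero Suc by auto
qed

text \<open>The cut just below the vertex \<open>ray \<xi> i\<close> separates the origin from the rest of the ray.\<close>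

lemma green_factor_along_ray:
  assumes "\<xi> \<in> tree_boundary E" "i \<le> n"
  shows "G orig (ray \<xi> n) * G (ray \<xi> i) (ray \<xi> i) = G orig (ray \<xi> i) * G (ray \<xi> i) (ray \<xi> n)"
proof (cases i)
  case 0
  then show ?thesis by (simp add: ray_props(2)[OF assms(1)])
next
  case (Suc m)
  note lev = ray_lev[OF assms(1)] and edge = ray_edge[OF assms(1)]
  let ?S = "cut_tree E (ray \<xi> m) (ray \<xi> i)"
  have ex: "sole_exit E ?S (ray \<xi> m) (ray \<xi> i)"
    using edge[of m] Suc by (intro cut_tree_sole_exit) simp
  have "ray \<xi> (m - m) \<in> ?S"
  proof (rule sole_exit_walk_inside[OF ex, of 0 m "\<lambda>k. ray \<xi> (m - k)"])
    show "ray \<xi> (m - 0) \<in> ?S" using sole_exitD[OF ex] by simp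
    \<comment> \<open>the ray is walked backwards, from level \<open>m\<close> to the origin\<close>
    show "E (ray \<xi> (m - k)) (ray \<xi> (m - Suc k))" if "k < m" for k
    proof -
      have "m - k = Suc (m - Suc k)" using that by simp
      then show ?thesis using edge_sym[OF edge[of "m - Suc k"]] by simp
    qed
    show "ray \<xi> (m - k) \<noteq> ray \<xi> i" for k
    proof
      assume "ray \<xi> (m - k) = ray \<xi> i"
      then have "m - k = i" by (metis lev)
      then show False using Suc by simp
    qed
  qed simp
  then have "orig \<in> ?S" using ray_props(2)[OF assms(1)] by simp
  moreover have "ray \<xi> n \<notin> ?S"
  proof (rule sole_exit_walk_outside[OF ex assms(2)])
    show "ray \<xi> i \<notin> ?S" using sole_exitD[OF ex] by simp
    show "ray \<xi> k \<noteq> ray \<xi> m" if "i \<le> k" for k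
      using lev[of k] lev[of m] Suc that by auto
  qed (rule edge)
  ultimately show ?thesis using green_ratio_across_cut[OF ex] by blast
qed

text \<open>Beyond the confluent \<open>c\<close> the arc to \<open>v\<close> leaves the ray, through a vertex \<open>y\<close>. The branch at
  \<open>y\<close> contains \<open>v\<close> and no vertex of the ray.\<close>

lemma green_factor_at_confluent:
  assumes \<xi>: "\<xi> \<in> tree_boundary E" and n: "lev v \<le> n"
  defines "c \<equiv> confluent E orig v \<xi>"
  shows "G v (ray \<xi> n) * G c c = G v c * G c (ray \<xi> n)"
proof (cases "v = c")
  case True
  then show ?thesis by simp
next
  case False
  note cp = confluent_props[OF \<xi>, where v = v, folded c_def]
  have c: "arc orig v ! lev c = c" "lev c \<le> lev v" using cp(1) by (auto simp: set_arc)
  have "lev c \<noteq> lev v"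
  proof
    assume "lev c = lev v"
    then have "arc orig v ! lev v = c" using c(1) by simp
    then show False using arc_nth_last[of v] False by simp
  qed
  with c(2) have less: "lev c < lev v" by simp
  define y where "y = arc orig v ! Suc (lev c)"
  have ly: "lev y = Suc (lev c)" using lev_arc_nth[of "Suc (lev c)" v] less by (simp add: y_def)
  have "E c y" using arc_nth_edge[OF less] unfolding y_def c(1) .
  then have ex: "sole_exit E (cut_tree E y c) y c" by (rule cut_tree_sole_exit[OF edge_sym])
  have "arc orig v ! lev v \<in> cut_tree E y c"
  proof (rule sole_exit_walk_inside[OF ex, of "Suc (lev c)"])
    show "Suc (lev c) \<le> lev v" using less by simp
    show "arc orig v ! Suc (lev c) \<in> cut_tree E y c"
      using sole_exitD(2)[OF ex] by (simp add: y_def)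
    show "E (arc orig v ! k) (arc orig v ! Suc k)" if "k < lev v" for k
      using that by (rule arc_nth_edge)
    show "arc orig v ! k \<noteq> c" if "Suc (lev c) \<le> k" "k \<le> lev v" for k
      using lev_arc_nth[OF that(2)] that(1) by auto
  qed
  then have v: "v \<in> cut_tree E y c" by (simp add: arc_nth_last)
  have y: "y \<notin> range (ray \<xi>)"
  proof
    assume "y \<in> range (ray \<xi>)"
    moreover have "y \<in> set (arc orig v)" unfolding y_def using less by (simp add: length_arc)
    ultimately have "lev y \<le> lev c" using cp(3) by blast
    then show False using ly by simp
  qed
  have "ray \<xi> n \<notin> cut_tree E y c"
  proof (rule sole_exit_walk_outside[OF ex, of "lev c"])
    show "lev c \<le> n" using less n by simp
    show "ray \<xi> (lev c) \<notin> cut_tree E y c" using sole_exitD(3)[OF ex] by (simp add: cp(2)[symmetric])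
    show "ray \<xi> k \<noteq> y" for k using y by auto
  qed (rule ray_edge[OF \<xi>])
  then show ?thesis using green_ratio_across_cut[OF ex _ v] by blast
qed

text \<open>The definition uses the confluent, which varies with \<open>v\<close>. Both factorisations move it to the
  vertex of the ray at a level \<open>n\<close> that is common to all \<open>v\<close> in a ball, and the kernel becomes a
  multiple of one Green function in \<open>v\<close>.\<close>

lemma poisson_kernel_eq:
  assumes "\<xi> \<in> tree_boundary E" "lev v \<le> n"
  shows "poisson_kernel E V orig \<gamma> \<xi> v = G v (ray \<xi> n) / G orig (ray \<xi> n)"
proof -
  define c where "c = confluent E orig v \<xi>"
  note cp = confluent_props[OF assms(1), where v = v, folded c_def]
  have "lev c \<le> n" using cp(1) assms(2) by (simp add: set_arc)
  from green_factor_along_ray[OF assms(1) this]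
  have a: "G orig (ray \<xi> n) * G c c = G orig c * G c (ray \<xi> n)" by (simp add: cp(2)[symmetric])
  have b: "G v (ray \<xi> n) * G c c = G v c * G c (ray \<xi> n)"
    using green_factor_at_confluent[OF assms] by (simp add: c_def)
  have "(G c v * G orig (ray \<xi> n)) * G c c = (G v (ray \<xi> n) * G orig c) * G c c"
    using arg_cong[OF a, of "\<lambda>t. G c v * t"] arg_cong[OF b, of "\<lambda>t. G orig c * t"]
    unfolding green_symmetric[of v c] by (simp only: mult_ac)
  then have "G c v * G orig (ray \<xi> n) = G v (ray \<xi> n) * G orig c"
    using green_diag_nonzero[of c] by simp
  then show ?thesis
    unfolding poisson_kernel_def c_def[symmetric]
    using green_orig_nonzero by (simp add: field_simps)
qed

section \<open>Finitely additive measures on the boundary\<close>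

abbreviation bd :: "(nat \<Rightarrow> 'v) set set" where "bd \<equiv> tree_boundary E"
abbreviation \<M> :: "(nat \<Rightarrow> 'v) set set set" where "\<M> \<equiv> boundary_algebra E orig"

lemma algebra_boundary_algebra: "algebra bd \<M>"
proof -
  define gen where "gen = {bdry w |w. w \<noteq> orig}"
  have mem: "A \<in> \<M> \<longleftrightarrow> (\<forall>t. algebra bd t \<and> gen \<subseteq> t \<longrightarrow> A \<in> t)" for A
    unfolding boundary_algebra_def hull_def gen_def[symmetric] by simp
  have "gen \<subseteq> Pow bd" by (auto simp: bdry_iff gen_def)
  moreover have "algebra bd (Pow bd)" by (simp add: algebra_iff_Un)
  ultimately have sub: "\<M> \<subseteq> Pow bd" using mem by blast
  show ?thesis
    unfolding algebra_iff_Un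
  proof (intro conjI ballI)
    show "\<M> \<subseteq> Pow bd" by fact
    show "{} \<in> \<M>" by (simp add: mem algebra_iff_Un)
    show "bd - a \<in> \<M>" if "a \<in> \<M>" for a using that by (simp add: mem algebra_iff_Un)
    show "a \<union> b \<in> \<M>" if "a \<in> \<M>" "b \<in> \<M>" for a b using that by (simp add: mem algebra_iff_Un)
  qed
qed

lemma bdry_in_algebra: "bdry w \<in> \<M>"
proof (cases "w = orig")
  case True
  then show ?thesis using algebra.top[OF algebra_boundary_algebra] bdry_orig by simp
next
  case False
  then show ?thesis unfolding boundary_algebra_def by (intro hull_inc) blast
qed

text \<open>Membership in \<open>A\<close> depends only on the vertex of the ray at level \<open>n\<close>. Every set in the algebra
  has this property for some \<open>n\<close>, and then for all larger ones.\<close>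

definition decided_at :: "nat \<Rightarrow> (nat \<Rightarrow> 'v) set set \<Rightarrow> bool" where
  "decided_at n A \<longleftrightarrow> A \<subseteq> bd \<and> (\<forall>v\<in>sphere_at n. bdry v \<subseteq> A \<or> bdry v \<inter> A = {})"

lemma bdry_subset_or_disjoint:
  assumes "lev v \<le> lev w"
  shows "bdry w \<subseteq> bdry v \<or> bdry w \<inter> bdry v = {}"
proof -
  have "\<xi>' \<in> bdry v" if "\<xi> \<in> bdry w" "\<xi> \<in> bdry v" "\<xi>' \<in> bdry w" for \<xi> \<xi>'
  proof -
    have "ray \<xi> (lev v) = ray \<xi>' (lev v)"
      by (rule rising_chain_unique_history[of _ _ "lev w"])
        (use that assms in \<open>auto simp: bdry_iff ray_edge ray_lev\<close>)
    then show ?thesis using that by (simp add: bdry_iff)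
  qed
  then show ?thesis by blast
qed

lemma decided_at_bdry: "lev w \<le> n \<Longrightarrow> decided_at n (bdry w)"
  using bdry_subset_or_disjoint[of w] by (auto simp: decided_at_def sphere_at_def bdry_iff)

lemma decided_at_mono:
  assumes "decided_at n A" "n \<le> m"
  shows "decided_at m A"
  unfolding decided_at_def
proof (intro conjI ballI)
  show "A \<subseteq> bd" using assms by (simp add: decided_at_def)
  fix v assume v: "v \<in> sphere_at m"
  show "bdry v \<subseteq> A \<or> bdry v \<inter> A = {}"
  proof (cases "bdry v = {}")
    case False
    then obtain \<xi> where \<xi>: "\<xi> \<in> bdry v" by blast
    then have "\<xi> \<in> bd" by (simp add: bdry_iff)
    define u where "u = ray \<xi> n"
    have u: "lev u = n" "\<xi> \<in> bdry u" using \<open>\<xi> \<in> bd\<close> ray_lev bdry_ray by (auto simp: u_def)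
    have "bdry v \<subseteq> bdry u"
      using bdry_subset_or_disjoint[of u v] u \<xi> v assms(2) by (auto simp: sphere_at_def)
    moreover have "bdry u \<subseteq> A \<or> bdry u \<inter> A = {}"
      using assms(1) u by (auto simp: decided_at_def sphere_at_def)
    ultimately show ?thesis by blast
  qed simp
qed

lemma decided_at_Un: "decided_at n A \<Longrightarrow> decided_at n B \<Longrightarrow> decided_at n (A \<union> B)"
  unfolding decided_at_def by blast

lemma decided_at_Diff: "decided_at n A \<Longrightarrow> decided_at n (bd - A)"
  unfolding decided_at_def by (auto simp: bdry_iff)

text \<open>The sets that are decided at some level form an algebra containing the generators.\<close>

lemma algebra_eventually_decided:
  assumes "A \<in> \<M>"
  shows "\<exists>n. decided_at n A"
proof -
  have "algebra bd {A. \<exists>n. decided_at n A}"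
    unfolding algebra_iff_Un
  proof (intro conjI ballI)
    show "{A. \<exists>n. decided_at n A} \<subseteq> Pow bd" by (auto simp: decided_at_def)
    show "{} \<in> {A. \<exists>n. decided_at n A}" by (simp add: decided_at_def)
    show "bd - a \<in> {A. \<exists>n. decided_at n A}" if "a \<in> {A. \<exists>n. decided_at n A}" for a
      using that decided_at_Diff by blast
    fix a b assume "a \<in> {A. \<exists>n. decided_at n A}" "b \<in> {A. \<exists>n. decided_at n A}"
    then obtain n m where "decided_at n a" "decided_at m b" by blast
    then have "decided_at (max n m) (a \<union> b)"
      by (intro decided_at_Un; elim decided_at_mono) auto
    then show "a \<union> b \<in> {A. \<exists>n. decided_at n A}" by blast
  qed
  moreover have "{bdry w |w. w \<noteq> orig} \<subseteq> {A. \<exists>n. decided_at n A}"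
    using decided_at_bdry by blast
  ultimately have "\<M> \<subseteq> {A. \<exists>n. decided_at n A}"
    unfolding boundary_algebra_def by (intro hull_minimal)
  then show ?thesis using assms by blast
qed

lemma decided_at_eq_Union:
  assumes "decided_at n A"
  shows "A = (\<Union>v\<in>{v \<in> sphere_at n. bdry v \<subseteq> A}. bdry v)"
proof
  show "A \<subseteq> (\<Union>v\<in>{v \<in> sphere_at n. bdry v \<subseteq> A}. bdry v)"
  proof
    fix \<xi> assume \<xi>: "\<xi> \<in> A"
    then have "\<xi> \<in> bd" using assms by (auto simp: decided_at_def)
    then have "\<xi> \<in> bdry (ray \<xi> n)" "ray \<xi> n \<in> sphere_at n"
      using bdry_ray ray_lev by (auto simp: sphere_at_def)
    moreover from this have "bdry (ray \<xi> n) \<subseteq> A" using assms \<xi> unfolding decided_at_def by blast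
    ultimately show "\<xi> \<in> (\<Union>v\<in>{v \<in> sphere_at n. bdry v \<subseteq> A}. bdry v)" by blast
  qed
qed blast

lemma additive_empty:
  assumes "additive \<M> (\<nu> :: _ \<Rightarrow> complex)"
  shows "\<nu> {} = 0"
proof -
  have e: "{} \<in> \<M>" using algebra_boundary_algebra by (simp add: algebra_iff_Un)
  show ?thesis using additiveD[OF assms _ e e] by simp
qed

lemma additive_sphere_Union:
  assumes add: "additive \<M> (\<nu> :: _ \<Rightarrow> complex)" and "finite F" "F \<subseteq> sphere_at n"
  shows "(\<Union>v\<in>F. bdry v) \<in> \<M> \<and> \<nu> (\<Union>v\<in>F. bdry v) = (\<Sum>v\<in>F. \<nu> (bdry v))"
  using assms(2,3)
proof (induction F rule: finite_induct)
  case empty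
  then show ?case using additive_empty[OF add] algebra_boundary_algebra by (simp add: algebra_iff_Un)
next
  case (insert x F)
  have disj: "bdry x \<inter> (\<Union>v\<in>F. bdry v) = {}"
  proof -
    have "bdry x \<inter> bdry v = {}" if "v \<in> F" for v
      by (rule bdry_disjoint) (use insert that in \<open>auto simp: sphere_at_def subset_iff\<close>)
    then show ?thesis by blast
  qed
  have IH: "(\<Union>v\<in>F. bdry v) \<in> \<M>" "\<nu> (\<Union>v\<in>F. bdry v) = (\<Sum>v\<in>F. \<nu> (bdry v))"
    using insert by auto
  have "(\<Union>v\<in>insert x F. bdry v) = bdry x \<union> (\<Union>v\<in>F. bdry v)" by simp
  moreover have "bdry x \<union> (\<Union>v\<in>F. bdry v) \<in> \<M>"
    using algebra_boundary_algebra bdry_in_algebra IH(1) by (simp add: algebra_iff_Un)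
  ultimately show ?case
    using additiveD[OF add disj bdry_in_algebra IH(1)] IH(2) insert.hyps by simp
qed

text \<open>The level sets of a function of the vertex at level \<open>n\<close> are finite disjoint unions of sets
  \<open>\<partial>T\<^sub>v\<close>, so the sum over values can be regrouped as a sum over the sphere. Vertices whose value of
  \<open>h\<close> is not attained by \<open>g\<close> have no boundary points and contribute zero.\<close>

lemma fa_integral_sphere:
  assumes add: "additive \<M> \<nu>" and g: "\<And>\<xi>. \<xi> \<in> bd \<Longrightarrow> g \<xi> = h (ray \<xi> n)"
  shows "fa_integral bd \<nu> g = (\<Sum>v\<in>sphere_at n. h v * \<nu> (bdry v))"
proof -
  define T where "T = {v \<in> sphere_at n. h v \<in> g ` bd}"
  have fin: "finite T" using finite_sphere by (simp add: T_def)
  have ray_T: "ray \<xi> n \<in> T" if "\<xi> \<in> bd" for \<xi>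
    using that g[OF that, symmetric] by (auto simp: T_def sphere_at_def ray_lev)
  have "g ` bd \<subseteq> h ` T" using g ray_T by auto
  then have fin_g: "finite (g ` bd)" using fin finite_surj by blast
  have level: "\<nu> {\<xi> \<in> bd. g \<xi> = y} = (\<Sum>v | v \<in> T \<and> h v = y. \<nu> (bdry v))" if y: "y \<in> g ` bd" for y
  proof -
    have "{\<xi> \<in> bd. g \<xi> = y} = (\<Union>v\<in>{v. v \<in> T \<and> h v = y}. bdry v)"
    proof (intro set_eqI iffI)
      fix \<xi> assume "\<xi> \<in> {\<xi> \<in> bd. g \<xi> = y}"
      then have "\<xi> \<in> bd" "h (ray \<xi> n) = y" using g by auto
      then show "\<xi> \<in> (\<Union>v\<in>{v. v \<in> T \<and> h v = y}. bdry v)" using ray_T bdry_ray by blast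
    next
      fix \<xi> assume "\<xi> \<in> (\<Union>v\<in>{v. v \<in> T \<and> h v = y}. bdry v)"
      then obtain v where "v \<in> sphere_at n" "h v = y" "\<xi> \<in> bdry v" by (auto simp: T_def)
      then show "\<xi> \<in> {\<xi> \<in> bd. g \<xi> = y}" using g by (auto simp: bdry_iff sphere_at_def)
    qed
    moreover have "finite {v. v \<in> T \<and> h v = y}" using fin by simp
    moreover have "{v. v \<in> T \<and> h v = y} \<subseteq> sphere_at n" by (auto simp: T_def)
    ultimately show ?thesis using additive_sphere_Union[OF add] by simp
  qed
  have "fa_integral bd \<nu> g = (\<Sum>y\<in>g ` bd. \<Sum>v | v \<in> T \<and> h v = y. h v * \<nu> (bdry v))"
    unfolding fa_integral_def by (intro sum.cong refl) (simp add: level sum_distrib_left)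
  also have "\<dots> = (\<Sum>v\<in>T. h v * \<nu> (bdry v))"
    by (rule sum.group) (use fin fin_g in \<open>auto simp: T_def\<close>)
  also have "\<dots> = (\<Sum>v\<in>sphere_at n. h v * \<nu> (bdry v))"
  proof (rule sum.mono_neutral_left)
    show "\<forall>v\<in>sphere_at n - T. h v * \<nu> (bdry v) = 0"
    proof
      fix v assume v: "v \<in> sphere_at n - T"
      have "bdry v = {}"
      proof (rule ccontr)
        assume "bdry v \<noteq> {}"
        then obtain \<xi> where "\<xi> \<in> bd" "ray \<xi> (lev v) = v" by (auto simp: bdry_iff)
        then show False using ray_T[of \<xi>] v by (auto simp: sphere_at_def)
      qed
      then show "h v * \<nu> (bdry v) = 0" using additive_empty[OF add] by simp
    qed
  qed (auto simp: finite_sphere T_def)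
  finally show ?thesis .
qed

section \<open>Poisson integrals are generalised eigenfunctions\<close>

lemma poisson_integral_sphere:
  assumes "additive \<M> \<nu>" "poisson_represents E V orig \<gamma> f \<nu>" "lev v \<le> n"
  shows "f v = (\<Sum>s\<in>sphere_at n. \<nu> (bdry s) / G orig s * G v s)"
proof -
  have "f v = fa_integral bd \<nu> (\<lambda>\<xi>. poisson_kernel E V orig \<gamma> \<xi> v)"
    using assms(2) by (simp add: poisson_represents_def)
  also have "\<dots> = (\<Sum>s\<in>sphere_at n. (G v s / G orig s) * \<nu> (bdry s))"
    by (rule fa_integral_sphere[OF assms(1)]) (rule poisson_kernel_eq[OF _ assms(3)])
  finally show ?thesis by (simp add: mult_ac)
qed

lemma schroedinger_sum:
  "H (\<lambda>v. \<Sum>s\<in>F. a s * \<phi> s v) v = (\<Sum>s\<in>F. a s * H (\<phi> s) v)"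
proof (induction F rule: infinite_finite_induct)
  case (insert x F)
  then show ?case by (simp add: schroedinger_add schroedinger_cmult)
qed (auto simp: schroedinger_def)

lemma poisson_integral_eigenfunction:
  assumes "additive \<M> \<nu>" "poisson_represents E V orig \<gamma> f \<nu>"
  shows "H f v = \<gamma> * f v"
proof -
  \<comment> \<open>one level beyond \<open>v\<close>, so that \<open>n\<close> serves \<open>v\<close> and its neighbours, and no \<open>s\<close> equals \<open>v\<close>\<close>
  let ?n = "Suc (lev v)"
  let ?\<phi> = "\<lambda>v. \<Sum>s\<in>sphere_at ?n. \<nu> (bdry s) / G orig s * G v s"
  note rep = poisson_integral_sphere[OF assms]
  have "f w = ?\<phi> w" if "E v w" for w
    using rep[of w ?n] lev_nbr[OF that] by auto
  then have "(\<Sum>w | E v w. f w) = (\<Sum>w | E v w. ?\<phi> w)" by (intro sum.cong) auto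
  moreover have "f v = ?\<phi> v" using rep[of v ?n] by simp
  ultimately have "H f v = H ?\<phi> v" by (simp only: schroedinger_def)
  also have "\<dots> = (\<Sum>s\<in>sphere_at ?n. \<nu> (bdry s) / G orig s * H (\<lambda>v. G v s) v)"
    by (rule schroedinger_sum)
  also have "\<dots> = (\<Sum>s\<in>sphere_at ?n. \<gamma> * (\<nu> (bdry s) / G orig s * G v s))"
    by (rule sum.cong) (auto simp: green_eqn sphere_at_def)
  also have "\<dots> = \<gamma> * f v"
    using rep[of v ?n] by (simp add: sum_distrib_left)
  finally show ?thesis .
qed

text \<open>With \<open>n = |w|\<close> all terms with \<open>s \<noteq> w\<close> cancel in \<open>f(w) - \<zeta>\<^sub>u(w) f(u)\<close>, as \<open>w\<close> is the only vertex of
  that level in its branch.\<close>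

lemma poisson_integral_boundary_values:
  assumes "additive \<M> \<nu>" "poisson_represents E V orig \<gamma> f \<nu>"
  shows "boundary_values E V orig \<gamma> f \<nu>"
  unfolding boundary_values_def
proof (intro conjI allI ballI)
  note rep = poisson_integral_sphere[OF assms]
  have "sphere_at 0 = {orig}" by (auto simp: sphere_at_def lev_eq_0)
  then show "\<nu> bd = f orig"
    using rep[of orig 0] green_diag_nonzero[of orig] by (simp add: lev_orig bdry_orig)
  fix u w assume "w \<in> forward_nbrs E orig u"
  then have w: "E u w" "lev w = Suc (lev u)" by (auto simp: forward_nbrs_iff)
  have "f w - \<zeta> u w * f u =
      (\<Sum>s\<in>sphere_at (lev w). \<nu> (bdry s) / G orig s * (G w s - \<zeta> u w * G u s))"
    using rep[of w "lev w"] rep[of u "lev w"] w(2)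
    by (simp add: sum_distrib_left sum_subtractf right_diff_distrib mult_ac)
  also have "\<dots> = (\<Sum>s\<in>sphere_at (lev w). if s = w then \<nu> (bdry w) / G orig w * (- \<zeta> u w) else 0)"
  proof (rule sum.cong)
    fix s assume s: "s \<in> sphere_at (lev w)"
    show "\<nu> (bdry s) / G orig s * (G w s - \<zeta> u w * G u s)
      = (if s = w then \<nu> (bdry w) / G orig w * (- \<zeta> u w) else 0)"
    proof (cases "s = w")
      case True
      then show ?thesis using green_step_diag[OF w(1)] by simp
    next
      case False
      then have "s \<notin> cut_tree E w u"
        using notin_branch_of_same_level[OF w] s by (simp add: sphere_at_def)
      then show ?thesis using green_step[OF w(1)] False by simp
    qed
  qed simp
  also have "\<dots> = - (\<nu> (bdry w) / G orig w * \<zeta> u w)"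
    using sphere_at_lev by (simp add: finite_sphere)
  finally have "- G orig u * (f w - \<zeta> u w * f u) = \<nu> (bdry w) / G orig w * (\<zeta> u w * G orig u)"
    by (simp add: mult_ac)
  also have "\<dots> = \<nu> (bdry w)"
    using green_orig_step[OF w] green_orig_nonzero[of w] by simp
  finally show "\<nu> (bdry w) = - G orig u * (f w - \<zeta> u w * f u)" by simp
qed

text \<open>Recursion from a vertex to its forward neighbours, possible as \<open>G(o,u) \<noteq> 0\<close>.\<close>

lemma boundary_values_determine_function:
  assumes "boundary_values E V orig \<gamma> f \<nu>" "boundary_values E V orig \<gamma> g \<nu>"
  shows "f v = g v"
proof (induction "lev v" arbitrary: v)
  case 0
  then show ?case using assms by (simp add: lev_eq_0 boundary_values_def)
next
  case (Suc n)
  then have "v \<noteq> orig" using lev_orig by auto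
  then obtain u where u: "E u v" "lev v = Suc (lev u)" using parent_exists by blast
  then have "v \<in> forward_nbrs E orig u" by (simp add: forward_nbrs_iff)
  then have "- G orig u * (f v - \<zeta> u v * f u) = - G orig u * (g v - \<zeta> u v * g u)"
    using assms unfolding boundary_values_def by metis
  then show ?case using Suc u green_orig_nonzero[of u] by simp
qed

lemma boundary_values_determine_measure:
  assumes "additive \<M> \<nu>" "boundary_values E V orig \<gamma> f \<nu>"
    and "additive \<M> \<nu>'" "boundary_values E V orig \<gamma> f \<nu>'" and "A \<in> \<M>"
  shows "\<nu>' A = \<nu> A"
proof -
  have eq: "\<nu>' (bdry v) = \<nu> (bdry v)" for v
  proof (cases "v = orig")
    case True
    then show ?thesis using assms by (simp add: bdry_orig boundary_values_def)
  next
    case False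
    then obtain u where u: "E u v" "lev v = Suc (lev u)" using parent_exists by blast
    then have "v \<in> forward_nbrs E orig u" by (simp add: forward_nbrs_iff)
    then show ?thesis using assms(2,4) unfolding boundary_values_def by metis
  qed
  obtain n where "decided_at n A" using algebra_eventually_decided assms(5) by blast
  then have A: "A = (\<Union>v\<in>{v \<in> sphere_at n. bdry v \<subseteq> A}. bdry v)" by (rule decided_at_eq_Union)
  have F: "finite {v \<in> sphere_at n. bdry v \<subseteq> A}" "{v \<in> sphere_at n. bdry v \<subseteq> A} \<subseteq> sphere_at n"
    using finite_sphere by auto
  have "\<nu>' A = (\<Sum>v\<in>{v \<in> sphere_at n. bdry v \<subseteq> A}. \<nu>' (bdry v))"
    using additive_sphere_Union[OF assms(3) F] A by simp
  also have "\<dots> = \<nu> A"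
    using additive_sphere_Union[OF assms(1) F] A by (simp add: eq)
  finally show ?thesis .
qed

section \<open>The measure of a generalised eigenfunction\<close>

text \<open>The value to be given to \<open>\<partial>T\<^sub>w\<close>: for \<open>w \<noteq> o\<close> with parent \<open>u\<close>, the Wronskian of \<open>f\<close> and
  \<open>G(o,\<cdot>)\<close> on the edge from \<open>u\<close> to \<open>w\<close>. In this form \<open>\<zeta>\<close> has disappeared.\<close>

definition weight :: "('v \<Rightarrow> complex) \<Rightarrow> 'v \<Rightarrow> complex" where
  "weight f w = (if w = orig then f orig
     else let u = arc orig w ! (lev w - 1) in f u * G orig w - f w * G orig u)"

lemma weight_orig: "weight f orig = f orig"
  by (simp add: weight_def)

lemma weight_forward:
  assumes "E u w" "lev w = Suc (lev u)"
  shows "weight f w = f u * G orig w - f w * G orig u"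
proof -
  have "arc orig w ! lev u = u"
    using arc_up[OF assms] arc_nth_last[of u] by (simp add: nth_append length_arc)
  moreover have "w \<noteq> orig" using assms lev_orig by auto
  ultimately show ?thesis by (simp add: weight_def assms(2))
qed

lemma weight_forward_zeta:
  assumes "E u w" "lev w = Suc (lev u)"
  shows "weight f w = - G orig u * (f w - \<zeta> u w * f u)"
  unfolding weight_forward[OF assms] green_orig_step[OF assms] by (simp add: algebra_simps)

lemma sum_nbrs_split:
  fixes g :: "'v \<Rightarrow> complex"
  shows "(\<Sum>w | E orig w. g w) = (\<Sum>w\<in>forward_nbrs E orig orig. g w)"
    and "E p u \<Longrightarrow> lev u = Suc (lev p) \<Longrightarrow> (\<Sum>w | E u w. g w) = g p + (\<Sum>w\<in>forward_nbrs E orig u. g w)"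
proof -
  have "{w. E orig w} = forward_nbrs E orig orig"
    using lev_nbr[of orig] by (auto simp: forward_nbrs_iff lev_orig)
  then show "(\<Sum>w | E orig w. g w) = (\<Sum>w\<in>forward_nbrs E orig orig. g w)" by simp
next
  assume p: "E p u" "lev u = Suc (lev p)"
  have "E u w \<longleftrightarrow> w = p \<or> w \<in> forward_nbrs E orig u" for w
  proof
    assume e: "E u w"
    show "w = p \<or> w \<in> forward_nbrs E orig u"
    proof (cases "lev w = Suc (lev u)")
      case True
      then show ?thesis using e by (simp add: forward_nbrs_iff)
    next
      case False
      then have "lev u = Suc (lev w)" using lev_nbr[OF e] by simp
      then show ?thesis using parent_unique[OF p(1) edge_sym[OF e] p(2)] by simp
    qed
  next
    assume "w = p \<or> w \<in> forward_nbrs E orig u"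
    then show "E u w" using edge_sym[OF p(1)] by (auto simp: forward_nbrs_iff)
  qed
  then have "{w. E u w} = insert p (forward_nbrs E orig u)" by auto
  moreover have "finite (forward_nbrs E orig u)" "p \<notin> forward_nbrs E orig u"
    using p finite_forward_nbrs by (auto simp: forward_nbrs_iff)
  ultimately show "(\<Sum>w | E u w. g w) = g p + (\<Sum>w\<in>forward_nbrs E orig u. g w)" by simp
qed

text \<open>Conservation of the Wronskian: multiply the equation of \<open>f\<close> at \<open>u\<close> by \<open>G(o,u)\<close> and that of
  \<open>G(o,\<cdot>)\<close> by \<open>f(u)\<close>, and subtract. The potential cancels and the edge to the parent carries the
  weight of \<open>u\<close>. At the origin there is no parent; the source of \<open>G(o,\<cdot>)\<close> contributes \<open>f(o)\<close>.\<close>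

lemma weight_additive:
  assumes "\<And>v. H f v = \<gamma> * f v"
  shows "(\<Sum>w\<in>forward_nbrs E orig u. weight f w) = weight f u"
proof -
  let ?k = "\<lambda>w. G w orig"
  define F where "F = (\<Sum>w\<in>forward_nbrs E orig u. f w)"
  define K where "K = (\<Sum>w\<in>forward_nbrs E orig u. ?k w)"
  have "weight f w = f u * ?k w - f w * ?k u" if "w \<in> forward_nbrs E orig u" for w
    using that weight_forward[of u w f] by (simp add: forward_nbrs_iff green_symmetric[of orig])
  then have sum: "(\<Sum>w\<in>forward_nbrs E orig u. weight f w) = f u * K - F * ?k u"
    by (simp add: sum_subtractf F_def K_def sum_distrib_left sum_distrib_right)
  have f: "(\<Sum>w | E u w. f w) = (\<gamma> - of_real (V u)) * f u"
    using assms[of u] by (simp add: schroedinger_def algebra_simps)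
  have k: "(\<Sum>w | E u w. ?k w) = (\<gamma> - of_real (V u)) * ?k u + (if u = orig then 1 else 0)"
    using green_eqn[of orig u] unfolding schroedinger_def by (auto simp: algebra_simps)
  show ?thesis
  proof (cases "u = orig")
    case True
    have FK: "F = (\<gamma> - of_real (V u)) * f u" "K = (\<gamma> - of_real (V u)) * ?k u + 1"
      using f k sum_nbrs_split(1)[of f] sum_nbrs_split(1)[of ?k] True by (simp_all add: F_def K_def)
    show ?thesis unfolding sum FK using True by (simp add: weight_orig algebra_simps)
  next
    case False
    then obtain p where p: "E p u" "lev u = Suc (lev p)" using parent_exists by blast
    have FK: "F = (\<gamma> - of_real (V u)) * f u - f p" "K = (\<gamma> - of_real (V u)) * ?k u - ?k p"
      using f k sum_nbrs_split(2)[OF p, of f] sum_nbrs_split(2)[OF p, of ?k] False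
      unfolding F_def[symmetric] K_def[symmetric] by (simp_all only: eq_diff_eq add.commute if_False add_0_left)
    show ?thesis unfolding sum FK weight_forward[OF p] green_symmetric[of orig]
      by (simp add: algebra_simps)
  qed
qed

text \<open>A nonzero weight is passed on to some forward neighbour, again and again, and so traces a
  chain. In particular finite branches have weight zero, as their empty boundary requires.\<close>

lemma weight_nonzero_boundary:
  assumes "\<And>v. H f v = \<gamma> * f v" "weight f w \<noteq> 0"
  shows "bdry w \<noteq> {}"
proof -
  have step: "\<exists>y. weight f y \<noteq> 0 \<and> y \<in> forward_nbrs E orig x" if "weight f x \<noteq> 0" for x
  proof (rule ccontr)
    assume "\<not> ?thesis"
    then have "(\<Sum>w\<in>forward_nbrs E orig x. weight f w) = 0" by (intro sum.neutral) blast
    then show False using weight_additive[OF assms(1), of x] that by simp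
  qed
  obtain c where c: "c 0 = w" "\<And>n. weight f (c n) \<noteq> 0" "\<And>n. c (Suc n) \<in> forward_nbrs E orig (c n)"
  proof -
    have "\<exists>c. \<forall>n. (weight f (c n) \<noteq> 0 \<and> (n = 0 \<longrightarrow> c n = w)) \<and> c (Suc n) \<in> forward_nbrs E orig (c n)"
      by (rule dependent_nat_choice) (use step assms(2) in auto)
    then show thesis using that by blast
  qed
  have up: "E (c n) (c (Suc n))" "lev (c (Suc n)) = Suc (lev (c n))" for n
    using c(3)[of n] by (auto simp: forward_nbrs_iff)
  have "c n \<noteq> c (n + 2)" for n
  proof
    assume "c n = c (n + 2)"
    then show False using up(2)[of n] up(2)[of "Suc n"] by simp
  qed
  then have "tree_chain E c" using up(1) by (simp add: tree_chain_def)
  from rising_chain_meets_boundary[OF this] up(2)[of 0] show ?thesis by (simp add: c(1))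
qed

text \<open>The measure of \<open>A\<close> computed at level \<open>n\<close>. It does not depend on \<open>n\<close> once \<open>A\<close> is decided there.\<close>

definition level_sum :: "('v \<Rightarrow> complex) \<Rightarrow> nat \<Rightarrow> (nat \<Rightarrow> 'v) set set \<Rightarrow> complex" where
  "level_sum f n A = (\<Sum>v\<in>sphere_at n. if bdry v \<subseteq> A then weight f v else 0)"

lemma sum_sphere_Suc:
  fixes g :: "'v \<Rightarrow> complex"
  shows "(\<Sum>w\<in>sphere_at (Suc n). g w) = (\<Sum>v\<in>sphere_at n. \<Sum>w\<in>forward_nbrs E orig v. g w)"
proof -
  have "sphere_at (Suc n) = (\<Union>v\<in>sphere_at n. forward_nbrs E orig v)"
  proof (intro set_eqI iffI)
    fix w assume w: "w \<in> sphere_at (Suc n)"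
    then have "w \<noteq> orig" by (auto simp: sphere_at_def lev_orig)
    then obtain u where "E u w" "lev w = Suc (lev u)" using parent_exists by blast
    then show "w \<in> (\<Union>v\<in>sphere_at n. forward_nbrs E orig v)"
      using w by (auto simp: sphere_at_def forward_nbrs_iff)
  qed (auto simp: sphere_at_def forward_nbrs_iff)
  then show ?thesis
    by (simp only:) (rule sum.UNION_disjoint,
      use parent_unique in \<open>auto simp: finite_sphere finite_forward_nbrs forward_nbrs_iff\<close>)
qed

lemma level_sum_Suc:
  assumes "\<And>v. H f v = \<gamma> * f v" "decided_at n A"
  shows "level_sum f (Suc n) A = level_sum f n A"
  unfolding level_sum_def sum_sphere_Suc
proof (rule sum.cong)
  fix v assume v: "v \<in> sphere_at n"
  show "(\<Sum>w\<in>forward_nbrs E orig v. if bdry w \<subseteq> A then weight f w else 0)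
      = (if bdry v \<subseteq> A then weight f v else 0)"
  proof (cases "bdry v \<subseteq> A")
    case True
    then have "bdry w \<subseteq> A" if "w \<in> forward_nbrs E orig v" for w
      using that boundary_at_children[of v] by blast
    then show ?thesis using True weight_additive[OF assms(1), of v] by simp
  next
    case False
    then have disj: "bdry v \<inter> A = {}" using assms(2) v by (auto simp: decided_at_def)
    have "(if bdry w \<subseteq> A then weight f w else 0) = 0" if "w \<in> forward_nbrs E orig v" for w
    proof -
      have "bdry w = {}" if "bdry w \<subseteq> A"
        using that disj \<open>w \<in> forward_nbrs E orig v\<close> boundary_at_children[of v] by blast
      then show ?thesis using weight_nonzero_boundary[OF assms(1)] by auto
    qed
    then have "(\<Sum>w\<in>forward_nbrs E orig v. if bdry w \<subseteq> A then weight f w else 0) = 0"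
      by (intro sum.neutral) blast
    then show ?thesis using False by simp
  qed
qed simp

text \<open>The sequence is eventually constant for \<open>A\<close> in the algebra; the limit avoids choosing a level.\<close>

definition boundary_measure :: "('v \<Rightarrow> complex) \<Rightarrow> (nat \<Rightarrow> 'v) set set \<Rightarrow> complex" where
  "boundary_measure f A = lim (\<lambda>n. level_sum f n A)"

lemma boundary_measure_eq:
  assumes "\<And>v. H f v = \<gamma> * f v" "decided_at n A"
  shows "boundary_measure f A = level_sum f n A"
proof -
  have "level_sum f m A = level_sum f n A" if "n \<le> m" for m
    using that
  proof (induction rule: dec_induct)
    case (step m)
    then show ?case using level_sum_Suc[OF assms(1) decided_at_mono[OF assms(2)]] by simp
  qed simp
  then have "(\<lambda>m. level_sum f m A) \<longlonglongrightarrow> level_sum f n A"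
    by (intro tendsto_eventually eventually_sequentiallyI)
  then show ?thesis unfolding boundary_measure_def by (rule limI)
qed

lemma boundary_measure_bdry:
  assumes "\<And>v. H f v = \<gamma> * f v"
  shows "boundary_measure f (bdry w) = weight f w"
proof -
  have "level_sum f (lev w) (bdry w) = (\<Sum>v\<in>sphere_at (lev w). if v = w then weight f w else 0)"
    unfolding level_sum_def
  proof (rule sum.cong)
    fix v assume v: "v \<in> sphere_at (lev w)"
    show "(if bdry v \<subseteq> bdry w then weight f v else 0) = (if v = w then weight f w else 0)"
    proof (cases "v = w")
      case False
      then have "bdry v \<inter> bdry w = {}" using v bdry_disjoint by (simp add: sphere_at_def)
      then show ?thesis using weight_nonzero_boundary[OF assms, of v] False by auto
    qed simp
  qed simp
  then show ?thesis
    using boundary_measure_eq[OF assms decided_at_bdry[of w "lev w"]]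
    using sphere_at_lev by (simp add: finite_sphere)
qed

text \<open>At a level that decides both sets, a nonempty \<open>\<partial>T\<^sub>v\<close> inside the union lies in exactly one of
  them, and vertices with empty \<open>\<partial>T\<^sub>v\<close> have weight zero.\<close>

lemma additive_boundary_measure:
  assumes "\<And>v. H f v = \<gamma> * f v"
  shows "additive \<M> (boundary_measure f)"
  unfolding additive_def
proof (intro ballI impI)
  fix A B assume "A \<in> \<M>" "B \<in> \<M>" and disj: "A \<inter> B = {}"
  then obtain m n where "decided_at m A" "decided_at n B" using algebra_eventually_decided by meson
  then obtain N where N: "decided_at N A" "decided_at N B"
    using decided_at_mono max.cobounded1 max.cobounded2 by meson
  have "level_sum f N (A \<union> B) = level_sum f N A + level_sum f N B"
    unfolding level_sum_def sum.distrib[symmetric]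
  proof (rule sum.cong)
    fix v assume v: "v \<in> sphere_at N"
    have d: "bdry v \<subseteq> A \<or> bdry v \<inter> A = {}" "bdry v \<subseteq> B \<or> bdry v \<inter> B = {}"
      using N v by (auto simp: decided_at_def)
    show "(if bdry v \<subseteq> A \<union> B then weight f v else 0)
        = (if bdry v \<subseteq> A then weight f v else 0) + (if bdry v \<subseteq> B then weight f v else 0)"
    proof (cases "bdry v = {}")
      case True
      then have "weight f v = 0" using weight_nonzero_boundary[OF assms] by blast
      then show ?thesis by simp
    next
      case False
      then have "bdry v \<subseteq> A \<union> B \<longleftrightarrow> bdry v \<subseteq> A \<or> bdry v \<subseteq> B" "\<not> (bdry v \<subseteq> A \<and> bdry v \<subseteq> B)"
        using d disj by blast+
      then show ?thesis by auto
    qed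
  qed simp
  then show "boundary_measure f (A \<union> B) = boundary_measure f A + boundary_measure f B"
    using boundary_measure_eq[OF assms] N decided_at_Un[OF N] by simp
qed

lemma boundary_measure_boundary_values:
  assumes "\<And>v. H f v = \<gamma> * f v"
  shows "boundary_values E V orig \<gamma> f (boundary_measure f)"
  unfolding boundary_values_def
proof (intro conjI allI ballI)
  show "boundary_measure f bd = f orig"
    using boundary_measure_bdry[OF assms, of orig] by (simp add: bdry_orig weight_orig)
  fix u w assume "w \<in> forward_nbrs E orig u"
  then show "boundary_measure f (bdry w) = - G orig u * (f w - \<zeta> u w * f u)"
    using weight_forward_zeta[of u w f] by (simp add: boundary_measure_bdry[OF assms] forward_nbrs_iff)
qed

text \<open>The Poisson integral of the measure has the same boundary values as \<open>f\<close>, and these determine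
  the function.\<close>

lemma boundary_measure_represents:
  assumes "\<And>v. H f v = \<gamma> * f v"
  shows "poisson_represents E V orig \<gamma> f (boundary_measure f)"
proof -
  define g where
    "g = (\<lambda>v. fa_integral bd (boundary_measure f) (\<lambda>\<xi>. poisson_kernel E V orig \<gamma> \<xi> v))"
  have rep: "poisson_represents E V orig \<gamma> g (boundary_measure f)"
    by (simp add: poisson_represents_def g_def)
  have "f = g"
    using boundary_values_determine_function[OF boundary_measure_boundary_values[OF assms]
        poisson_integral_boundary_values[OF additive_boundary_measure[OF assms] rep]]
    by (rule ext)
  then show ?thesis using rep by simp
qed

end

theorem theorem3p3:
  fixes E :: "'v \<Rightarrow> 'v \<Rightarrow> bool"
    and V :: "'v \<Rightarrow> real"
    and orig :: 'v
    and \<gamma> :: complex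
    and f :: "'v \<Rightarrow> complex"
  assumes "bounded_degree_tree E"
    and "Im \<gamma> > 0"
  shows
    "(\<forall>\<nu>. additive (boundary_algebra E orig) \<nu> \<and> poisson_represents E V orig \<gamma> f \<nu> \<longrightarrow>
        (\<forall>v. schroedinger E V f v = \<gamma> * f v) \<and> boundary_values E V orig \<gamma> f \<nu>)
     \<and> ((\<forall>v. schroedinger E V f v = \<gamma> * f v) \<longrightarrow>
        (\<exists>\<nu>. additive (boundary_algebra E orig) \<nu> \<and> boundary_values E V orig \<gamma> f \<nu> \<and>
             poisson_represents E V orig \<gamma> f \<nu> \<and>
             (\<forall>\<nu>'. additive (boundary_algebra E orig) \<nu>' \<and> boundary_values E V orig \<gamma> f \<nu>' \<longrightarrow>
                (\<forall>A\<in>boundary_algebra E orig. \<nu>' A = \<nu> A))))"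
proof -
  interpret graph_tree E orig by unfold_locales (rule assms(1))
  interpret schroedinger_tree E orig V \<gamma>
    using assms by unfold_locales (auto simp: bounded_degree_tree_def dest: sympD)
  show ?thesis
  proof (intro conjI allI impI)
    fix \<nu> assume "additive (boundary_algebra E orig) \<nu> \<and> poisson_represents E V orig \<gamma> f \<nu>"
    then show "schroedinger E V f v = \<gamma> * f v" and "boundary_values E V orig \<gamma> f \<nu>" for v
      using poisson_integral_eigenfunction poisson_integral_boundary_values by blast+
  next
    assume "\<forall>v. schroedinger E V f v = \<gamma> * f v"
    then have eig: "schroedinger E V f v = \<gamma> * f v" for v by blast
    show "\<exists>\<nu>. additive (boundary_algebra E orig) \<nu> \<and> boundary_values E V orig \<gamma> f \<nu> \<and>
             poisson_represents E V orig \<gamma> f \<nu> \<and>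
             (\<forall>\<nu>'. additive (boundary_algebra E orig) \<nu>' \<and> boundary_values E V orig \<gamma> f \<nu>' \<longrightarrow>
                (\<forall>A\<in>boundary_algebra E orig. \<nu>' A = \<nu> A))"
      using additive_boundary_measure[OF eig] boundary_measure_boundary_values[OF eig]
        boundary_measure_represents[OF eig] boundary_values_determine_measure
      by (intro exI[of _ "boundary_measure f"]) blast
  qed
qed

end
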